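(* Let $\mathsf k$ be a field of characteristic $\ne 3$ and let $J$ be a $9$-dimensional quadratic Jordan algebra of a cubic form over $\mathsf k$ with the basis $\pi_1,\pi_2,\pi_3,\pi_4,\upsilon_1,\upsilon_2,\sigma_1,\sigma_2,\sigma_3$ and the ten parameters $t_1,t_2,t_{123},t_{124},t_{125},t_{126},t_{135},t_{136},t_{245},t_{246}\in\mathsf k$ described in the context. Let $p_1,p_2,p_3,p_4,u_1,u_2,s_1,s_2,s_3$ be the coordinates of an element $$x=p_1\pi_1+p_2\pi_2+p_3\pi_3+p_4\pi_4+u_1\upsilon_1+u_2\upsilon_2+s_1\sigma_1+s_2\sigma_2+s_3\sigma_3$$ of $J$. Then the $\sharp$-mapping $J\to J$ is defined by $$(p_1,p_2,p_3,p_4,u_1,u_2,s_1,s_2,s_3)\mapsto(\mathrm{ad}\,p_1,\mathrm{ad}\,p_2,\mathrm{ad}\,p_3,\mathrm{ad}\,p_4,\mathrm{ad}\,u_1,\mathrm{ad}\,u_2,\mathrm{ad}\,s_1,\mathrm{ad}\,s_2,\mathrm{ad}\,s_3)$$ satisfying $$3\,\mathrm{ad}\,p_2=F_1,\quad 3\,\mathrm{ad}\,p_4=F_2,\quad 3\,\mathrm{ad}\,p_1=F_3,\quad 3\,\mathrm{ad}\,p_3=F_4,$$ $$-3(\mathrm{ad}\,u_1+t_1\,\mathrm{ad}\,p_2)=F_5,\quad -3(\mathrm{ad}\,u_2+t_1\,\mathrm{ad}\,p_4)=F_6,\quad -3\,\mathrm{ad}\,s_1=F_7,\quad -3\,\mathrm{ad}\,s_2=F_8,$$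 $$3(\mathrm{ad}\,s_3+t_1\,\mathrm{ad}\,s_1-t_{125}\,\mathrm{ad}\,p_1+t_{123}\,\mathrm{ad}\,p_2-t_{126}\,\mathrm{ad}\,p_3+t_{124}\,\mathrm{ad}\,p_4)=F_9,$$ where $F_1,\dots,F_9$ are the polynomials given in the context.
   Context: **Quadratic Jordan algebra of a cubic form.** A finite-dimensional $\mathsf k$-vector space $J$ with a cubic form $N$, a quadratic map $x\mapsto x^\sharp$ and an element $\mathfrak 1$ with $N(\mathfrak 1)=1$ such that (strictly, i.e. after all field extensions) $(x^\sharp)^\sharp=N(x)x$, $\partial_yN(x)=T(x^\sharp,y)$, $\mathfrak 1\sharp y=T(y)\mathfrak 1-y$, where $x\sharp y=(x+y)^\sharp-x^\sharp-y^\sharp$, $T(x,y)=\partial_xN(\mathfrak 1)\,\partial_yN(\mathfrak 1)-\partial_x\partial_yN(\mathfrak 1)$ is the bilinear trace and $T(x)=T(x,\mathfrak 1)$. Put $S(x)=T(x^\sharp)$. **Standing assumptions on $J$.** $\dim J=9$, $J$ is nondegenerate and simple, $T$ is nondegenerate, and $\mathfrak 1$ is a sum of three orthogonal primitive idempotents. **Choice of $\sigma,\upsilon$.** For $\sigma,\upsilon\in J$ with $T(\sigma)=T(\upsilon)=0$ put $S_1=S(\sigma)$, $S_2=S(\upsilon)$, $N_1=N(\sigma)$, $N_2=N(\upsilon)$, $T_{11}=T(\sigma,\upsilon)$, $T_{12}=T(\sigma,\upsilon^\sharp)$, $T_{21}=T(\sigma^\sharp,\upsilon)$, $T_{22}=T(\sigma^\sharp,\upsilon^\sharp)$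 and $\mathsf D=27N_1^2N_2^2+4N_1^2S_2^3+4N_2^2S_1^3+6N_1N_2S_1S_2T_{11}-S_1^2S_2^2T_{11}^2+4N_1N_2T_{11}^3+4N_1S_1S_2^2T_{12}+4N_2S_1^2S_2T_{21}+4N_1S_2^2T_{11}T_{21}+4N_2S_1^2T_{11}T_{12}+4N_1S_2T_{11}^2T_{12}+4N_2S_1T_{11}^2T_{21}-18N_1N_2T_{12}T_{21}-18N_1N_2T_{11}T_{22}-T_{12}^2T_{21}^2+4N_1T_{12}^3+4N_2T_{21}^3+4S_1^2S_2^2T_{22}+2S_1S_2T_{11}T_{12}T_{21}+2S_1S_2T_{11}^2T_{22}-12N_1S_2T_{12}T_{22}-12N_2S_1T_{21}T_{22}+2T_{11}T_{12}T_{21}T_{22}+4S_1T_{12}^2T_{22}+4S_2T_{21}^2T_{22}-8S_1S_2T_{22}^2-T_{11}^2T_{22}^2+4T_{22}^3$. Fix $\sigma,\upsilon$ with $T(\sigma)=T(\upsilon)=0$ and $\mathsf D\ne0$ (such elements exist); then $\mathfrak 1,\sigma,\sigma^\sharp,\upsilon,\upsilon^\sharp,\sigma\sharp\upsilon,\sigma\sharp\upsilon^\sharp,\sigma^\sharp\sharp\upsilon,\sigma^\sharp\sharp\upsilon^\sharp$ is a basis of $J$. **Basis and parameters.** Set $\sigma_2=\sigma$, $\sigma_1=\sigma^\sharp$, $\sigma_3=\mathfrak 1$, $\upsilon_1=\upsilon$, $t_1=S(\sigma)$, $t_2=N(\sigma)$. Let $\upsilon_2\in\langle\upsilon_1,\upsilon_1^\sharp,\mathfrak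 1\rangle$ be an element with $T(\upsilon_2)=0$ and $\langle\upsilon_1,\upsilon_1^\sharp,\mathfrak 1\rangle=\langle\upsilon_1,\upsilon_2,\mathfrak 1\rangle$. Set $t_{123}=-T(\sigma_1,\upsilon_1)$, $t_{124}=-T(\sigma_1,\upsilon_2)$, $t_{125}=T(\sigma_2,\upsilon_1)$, $t_{126}=T(\sigma_2,\upsilon_2)$, and define $t_{135},t_{136},t_{245},t_{246}$ by $\upsilon_1^\sharp=t_{136}\upsilon_1-t_{135}\upsilon_2+\tfrac13S(\upsilon_1)\mathfrak 1$, $\ \upsilon_2^\sharp=t_{246}\upsilon_1-t_{245}\upsilon_2+\tfrac13S(\upsilon_2)\mathfrak 1$. Set $\pi_1=\sigma_2\sharp\upsilon_1$, $\pi_2=\sigma_2^\sharp\sharp\upsilon_1+t_1\upsilon_1$, $\pi_3=\sigma_2\sharp\upsilon_2$, $\pi_4=\sigma_2^\sharp\sharp\upsilon_2+t_1\upsilon_2$. **The polynomials.** Abbreviate $d=p_1p_4-p_2p_3$; $U_1=p_1^2+t_1p_2^2+p_2u_1$, $U_2=2p_1p_3+2t_1p_2p_4+p_4u_1+p_2u_2$, $U_3=p_3^2+t_1p_4^2+p_4u_2$; $I_1=t_2p_2^2+p_1u_1$, $I_2=2t_2p_2p_4+p_3u_1+p_1u_2$, $I_3=t_2p_4^2+p_3u_2$; $A_1=t_1p_2u_1-t_2p_1p_2+u_1^2$, $A_2=t_1(p_4u_1+p_2u_2)-t_2(p_2p_3+p_1p_4)+2u_1u_2$, $A_3=t_1p_4u_2-t_2p_3p_4+u_2^2$;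 $\alpha=t_{136}^2-t_{135}t_{245}$, $\beta=t_{135}t_{246}-t_{136}t_{245}$, $\gamma=t_{245}^2-t_{136}t_{246}$; $a_0=t_{123}t_{136}-t_{124}t_{135}$, $a_1=t_{123}t_{245}-t_{124}t_{136}$, $a_2=t_{123}t_{246}-t_{124}t_{245}$; $b_0=t_{125}t_{136}-t_{126}t_{135}$, $b_1=t_{125}t_{245}-t_{126}t_{136}$, $b_2=t_{125}t_{246}-t_{126}t_{245}$. Then $F_1=u_1s_1-p_1s_2-p_2s_3-t_{126}d-(t_{136}U_1+t_{245}U_2+t_{246}U_3)$, $F_2=u_2s_1-p_3s_2-p_4s_3+t_{125}d+t_{135}U_1+t_{136}U_2+t_{245}U_3$, $F_3=-t_2p_2s_1+(t_1p_2+u_1)s_2-p_1s_3-t_{124}d-(t_{136}I_1+t_{245}I_2+t_{246}I_3)$, $F_4=-t_2p_4s_1+(t_1p_4+u_2)s_2-p_3s_3+t_{123}d+t_{135}I_1+t_{136}I_2+t_{245}I_3$, $F_5=-t_2p_1s_1+(t_1p_1-t_2p_2)s_2+(t_1p_2+u_1)s_3+t_{123}U_1+t_{124}(p_1p_3+t_1p_2p_4+p_2u_2)-t_{125}I_1-t_{126}(t_2p_2p_4+p_1u_2)-(t_{136}A_1+t_{245}A_2+t_{246}A_3)$, $F_6=-t_2p_3s_1+(t_1p_3-t_2p_4)s_2+(t_1p_4+u_2)s_3+t_{123}(p_1p_3+t_1p_2p_4+p_4u_1)+t_{124}U_3-t_{125}(t_2p_2p_4+p_3u_1)-t_{126}I_3+t_{135}A_1+t_{136}A_2+t_{245}A_3$,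 $F_7=s_1s_3-s_2^2+(t_{123}p_2+t_{124}p_4)s_1-(t_{125}p_2+t_{126}p_4)s_2+\alpha(p_1^2-2p_2u_1-t_1p_2^2)+\gamma(p_3^2-2p_4u_2-t_1p_4^2)+\beta(p_2u_2+p_4u_1-p_1p_3+t_1p_2p_4)+a_0p_2^2+2a_1p_2p_4+a_2p_4^2-b_0p_1p_2-b_1(p_1p_4+p_2p_3)-b_2p_3p_4$, $F_8=s_2s_3+t_1s_1s_2-t_2s_1^2+(t_{123}p_1+t_{124}p_3)s_1-(t_{125}p_1+t_{126}p_3)s_2+\alpha(-2p_1u_1-2t_1p_1p_2+t_2p_2^2)+\gamma(-2p_3u_2-2t_1p_3p_4+t_2p_4^2)+\beta\big(p_1u_2+p_3u_1+t_1(p_1p_4+p_2p_3)-t_2p_2p_4\big)-b_0p_1^2-2b_1p_1p_3-b_2p_3^2+a_0p_1p_2+a_1(p_1p_4+p_2p_3)+a_2p_3p_4$, $F_9=s_3^2+t_1s_2^2-t_2s_1s_2+(t_{123}u_1+t_{124}u_2)s_1-(t_{125}u_1+t_{126}u_2)s_2-\alpha(2t_2p_1p_2+u_1^2)+\beta\big(t_2(p_2p_3+p_1p_4)+u_1u_2\big)-\gamma(2t_2p_3p_4+u_2^2)-t_1(a_0p_2^2+2a_1p_2p_4+a_2p_4^2)+t_2(b_0p_2^2+2b_1p_2p_4+b_2p_4^2)-a_0p_1^2-2a_1p_1p_3-a_2p_3^2+(t_{124}t_{125}-t_{123}t_{126})d$.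
   Formalization: The factor 3 on the left of all nine equations is dropped (ad p_2 = F_1, ..., -(ad u_1 + t_1 ad p_2) = F_5, ...): as printed they fail for x = σ_3 = 1, where 1^# = 1 and F_9 = 1 would give 3 = 1, unless the characteristic is 2, where both versions agree. *)

theory Defs
  imports
    "HOL-Algebra.Ring"
    "HOL-Computational_Algebra.Polynomial"
    "HOL-Computational_Algebra.Fraction_Field"
begin

section \<open>Quadratic maps and cubic forms\<close>

definition polar :: "('a::ab_group_add \<Rightarrow> 'b::ab_group_add) \<Rightarrow> 'a \<Rightarrow> 'a \<Rightarrow> 'b" where
  "polar q x y = q (x + y) - q x - q y"

definition quadratic_map ::
  "('k::field \<Rightarrow> 'a::ab_group_add \<Rightarrow> 'a) \<Rightarrow> ('k \<Rightarrow> 'b::ab_group_add \<Rightarrow> 'b) \<Rightarrow> ('a \<Rightarrow> 'b) \<Rightarrow> bool"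
where
  "quadratic_map s1 s2 q \<longleftrightarrow>
     (\<forall>c x. q (s1 c x) = s2 (c\<^sup>2) (q x)) \<and> (\<forall>x. Vector_Spaces.linear s1 s2 (polar q x))"

text \<open>
  A cubic form is a homogeneous polynomial of degree 3. Over a small field it is not determined
  by its values, so it is given, as usual, by the pair of its value map \<open>N\<close> and its first
  directional derivative, \<open>dN x y\<close> standing for \<open>\<partial>\<^sub>y N(x)\<close>. Such pairs correspond
  bijectively to cubic polynomials: in coordinates with respect to \<open>e\<close>, the coefficient of
  \<open>x\<^sub>i^3\<close> is \<open>N (e i)\<close>, that of \<open>x\<^sub>i^2 x\<^sub>j\<close> is \<open>dN (e i) (e j)\<close>, and that of
  \<open>x\<^sub>i x\<^sub>j x\<^sub>k\<close> is \<open>d2N dN (e i) (e j) (e k)\<close>.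
\<close>

definition cubic_form ::
  "('k::field \<Rightarrow> 'a::ab_group_add \<Rightarrow> 'a) \<Rightarrow> ('a \<Rightarrow> 'k) \<Rightarrow> ('a \<Rightarrow> 'a \<Rightarrow> 'k) \<Rightarrow> bool"
where
  "cubic_form s N dN \<longleftrightarrow>
     (\<forall>c x. N (s c x) = c ^ 3 * N x) \<and>
     (\<forall>x y. N (x + y) = N x + dN x y + dN y x + N y) \<and>
     (\<forall>x. dN x x = 3 * N x) \<and>
     (\<forall>x. Vector_Spaces.linear s (*) (dN x)) \<and>
     (\<forall>y. quadratic_map s (*) (\<lambda>x. dN x y))"

text \<open>\<open>d2N dN x y z\<close> is \<open>\<partial>\<^sub>y \<partial>\<^sub>z N(x)\<close>.\<close>

definition d2N :: "('a::ab_group_add \<Rightarrow> 'a \<Rightarrow> 'k::field) \<Rightarrow> 'a \<Rightarrow> 'a \<Rightarrow> 'a \<Rightarrow> 'k" where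
  "d2N dN x y z = polar (\<lambda>w. dN w z) x y"

definition trace_form :: "('a::ab_group_add \<Rightarrow> 'a \<Rightarrow> 'k::field) \<Rightarrow> 'a \<Rightarrow> 'a \<Rightarrow> 'a \<Rightarrow> 'k" where
  "trace_form dN unt x y = dN unt x * dN unt y - d2N dN unt x y"


section \<open>Scalar extension in coordinates\<close>

definition ordered_basis ::
  "('k::field \<Rightarrow> 'a::ab_group_add \<Rightarrow> 'a) \<Rightarrow> nat \<Rightarrow> (nat \<Rightarrow> 'a) \<Rightarrow> bool"
where
  "ordered_basis s n e \<longleftrightarrow> inj_on e {..<n} \<and>
     \<not> module.dependent s (e ` {..<n}) \<and> module.span s (e ` {..<n}) = UNIV"

definition coord ::
  "('k::field \<Rightarrow> 'a::ab_group_add \<Rightarrow> 'a) \<Rightarrow> nat \<Rightarrow> (nat \<Rightarrow> 'a) \<Rightarrow> nat \<Rightarrow> 'a \<Rightarrow> 'k"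
where
  "coord s n e m x = module.representation s (e ` {..<n}) x (e m)"

definition field_extension :: "('u, 'm) ring_scheme \<Rightarrow> ('k::field \<Rightarrow> 'u) \<Rightarrow> bool" where
  "field_extension L h \<longleftrightarrow> field L \<and>
     h \<in> ring_hom \<lparr>carrier = UNIV, monoid.mult = (*), one = 1, zero = 0, add = (+)\<rparr> L"

text \<open>
  For a field extension \<open>h\<close> of the ground field into \<open>L\<close>, the vectors of the extended space are
  the coordinate families \<open>x \<in> {..<n} \<rightarrow>\<^sub>E carrier L\<close> with respect to the basis \<open>e\<close>, and
  \<open>ext_quad\<close>, \<open>ext_cubic\<close>, \<open>ext_deriv\<close>, \<open>ext_bilin\<close> are the extensions of a quadratic form, of a
  cubic form, of its derivative and of a bilinear form.
\<close>

definition ext_quad ::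
  "('u, 'm) ring_scheme \<Rightarrow> ('k::field \<Rightarrow> 'u) \<Rightarrow> nat \<Rightarrow> (nat \<Rightarrow> 'a::ab_group_add) \<Rightarrow>
   ('a \<Rightarrow> 'k) \<Rightarrow> (nat \<Rightarrow> 'u) \<Rightarrow> 'u"
where
  "ext_quad L h n e q x =
     (\<Oplus>\<^bsub>L\<^esub>i\<in>{..<n}. h (q (e i)) \<otimes>\<^bsub>L\<^esub> (x i \<otimes>\<^bsub>L\<^esub> x i)) \<oplus>\<^bsub>L\<^esub>
     (\<Oplus>\<^bsub>L\<^esub>j\<in>{..<n}. \<Oplus>\<^bsub>L\<^esub>i\<in>{..<j}. h (polar q (e i) (e j)) \<otimes>\<^bsub>L\<^esub> (x i \<otimes>\<^bsub>L\<^esub> x j))"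

definition ext_cubic ::
  "('u, 'm) ring_scheme \<Rightarrow> ('k::field \<Rightarrow> 'u) \<Rightarrow> nat \<Rightarrow> (nat \<Rightarrow> 'a::ab_group_add) \<Rightarrow>
   ('a \<Rightarrow> 'k) \<Rightarrow> ('a \<Rightarrow> 'a \<Rightarrow> 'k) \<Rightarrow> (nat \<Rightarrow> 'u) \<Rightarrow> 'u"
where
  "ext_cubic L h n e N dN x =
     (\<Oplus>\<^bsub>L\<^esub>i\<in>{..<n}. h (N (e i)) \<otimes>\<^bsub>L\<^esub> (x i \<otimes>\<^bsub>L\<^esub> x i \<otimes>\<^bsub>L\<^esub> x i)) \<oplus>\<^bsub>L\<^esub>
     (\<Oplus>\<^bsub>L\<^esub>i\<in>{..<n}. \<Oplus>\<^bsub>L\<^esub>j\<in>{..<n} - {i}.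
        h (dN (e i) (e j)) \<otimes>\<^bsub>L\<^esub> (x i \<otimes>\<^bsub>L\<^esub> x i \<otimes>\<^bsub>L\<^esub> x j)) \<oplus>\<^bsub>L\<^esub>
     (\<Oplus>\<^bsub>L\<^esub>k\<in>{..<n}. \<Oplus>\<^bsub>L\<^esub>j\<in>{..<k}. \<Oplus>\<^bsub>L\<^esub>i\<in>{..<j}.
        h (d2N dN (e i) (e j) (e k)) \<otimes>\<^bsub>L\<^esub> (x i \<otimes>\<^bsub>L\<^esub> x j \<otimes>\<^bsub>L\<^esub> x k))"

definition ext_deriv ::
  "('u, 'm) ring_scheme \<Rightarrow> ('k::field \<Rightarrow> 'u) \<Rightarrow> nat \<Rightarrow> (nat \<Rightarrow> 'a::ab_group_add) \<Rightarrow>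
   ('a \<Rightarrow> 'a \<Rightarrow> 'k) \<Rightarrow> (nat \<Rightarrow> 'u) \<Rightarrow> (nat \<Rightarrow> 'u) \<Rightarrow> 'u"
where
  "ext_deriv L h n e dN x y =
     (\<Oplus>\<^bsub>L\<^esub>j\<in>{..<n}. ext_quad L h n e (\<lambda>w. dN w (e j)) x \<otimes>\<^bsub>L\<^esub> y j)"

definition ext_bilin ::
  "('u, 'm) ring_scheme \<Rightarrow> ('k::field \<Rightarrow> 'u) \<Rightarrow> nat \<Rightarrow> (nat \<Rightarrow> 'a::ab_group_add) \<Rightarrow>
   ('a \<Rightarrow> 'a \<Rightarrow> 'k) \<Rightarrow> (nat \<Rightarrow> 'u) \<Rightarrow> (nat \<Rightarrow> 'u) \<Rightarrow> 'u"
where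
  "ext_bilin L h n e B x y =
     (\<Oplus>\<^bsub>L\<^esub>i\<in>{..<n}. \<Oplus>\<^bsub>L\<^esub>j\<in>{..<n}. h (B (e i) (e j)) \<otimes>\<^bsub>L\<^esub> (x i \<otimes>\<^bsub>L\<^esub> y j))"

definition ext_sharp ::
  "('u, 'm) ring_scheme \<Rightarrow> ('k::field \<Rightarrow> 'u) \<Rightarrow> ('k \<Rightarrow> 'a::ab_group_add \<Rightarrow> 'a) \<Rightarrow> nat \<Rightarrow>
   (nat \<Rightarrow> 'a) \<Rightarrow> ('a \<Rightarrow> 'a) \<Rightarrow> (nat \<Rightarrow> 'u) \<Rightarrow> nat \<Rightarrow> 'u"
where
  "ext_sharp L h s n e sharp x =
     (\<lambda>m\<in>{..<n}. ext_quad L h n e (\<lambda>w. coord s n e m (sharp w)) x)"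

definition cubic_identities ::
  "('u, 'm) ring_scheme \<Rightarrow> ('k::field \<Rightarrow> 'u) \<Rightarrow> ('k \<Rightarrow> 'a::ab_group_add \<Rightarrow> 'a) \<Rightarrow> nat \<Rightarrow>
   (nat \<Rightarrow> 'a) \<Rightarrow> ('a \<Rightarrow> 'k) \<Rightarrow> ('a \<Rightarrow> 'a \<Rightarrow> 'k) \<Rightarrow> ('a \<Rightarrow> 'a) \<Rightarrow> 'a \<Rightarrow> bool"
where
  "cubic_identities L h s n e N dN sharp unt \<longleftrightarrow>
    (let J = {..<n} \<rightarrow>\<^sub>E carrier L;
         sh = ext_sharp L h s n e sharp;
         T = ext_bilin L h n e (trace_form dN unt);
         u = (\<lambda>m\<in>{..<n}. h (coord s n e m unt))
     in (\<forall>x\<in>J. \<forall>m<n. sh (sh x) m = ext_cubic L h n e N dN x \<otimes>\<^bsub>L\<^esub> x m) \<and>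
        (\<forall>x\<in>J. \<forall>y\<in>J. ext_deriv L h n e dN x y = T (sh x) y) \<and>
        (\<forall>y\<in>J. \<forall>m<n.
           sh (\<lambda>i\<in>{..<n}. u i \<oplus>\<^bsub>L\<^esub> y i) m \<ominus>\<^bsub>L\<^esub> sh u m \<ominus>\<^bsub>L\<^esub> sh y m =
           T y u \<otimes>\<^bsub>L\<^esub> u m \<ominus>\<^bsub>L\<^esub> y m))"


section \<open>Quadratic Jordan algebras of a cubic form\<close>

text \<open>
  The identities are required after every field extension. The field structures \<open>L\<close> range over
  all those carried by subsets of the type \<open>'k poly fract\<close>; this loses no extension, since a
  failure of a polynomial identity over some extension already occurs over a finitely generated
  one, whose cardinality is at most that of \<open>'k poly fract\<close>. They do not depend on the
  choice of the basis \<open>e\<close>.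
\<close>

definition cubic_jordan_algebra ::
  "('k::field \<Rightarrow> 'a::ab_group_add \<Rightarrow> 'a) \<Rightarrow> ('a \<Rightarrow> 'k) \<Rightarrow> ('a \<Rightarrow> 'a \<Rightarrow> 'k) \<Rightarrow> ('a \<Rightarrow> 'a) \<Rightarrow> 'a \<Rightarrow> bool"
where
  "cubic_jordan_algebra s N dN sharp unt \<longleftrightarrow>
     vector_space s \<and> cubic_form s N dN \<and> quadratic_map s s sharp \<and> N unt = 1 \<and>
     (\<exists>n e. ordered_basis s n e \<and>
        (\<forall>(L :: 'k poly fract ring) h. field_extension L h \<longrightarrow>
            cubic_identities L h s n e N dN sharp unt))"

definition U_op ::
  "('k::field \<Rightarrow> 'a::ab_group_add \<Rightarrow> 'a) \<Rightarrow> ('a \<Rightarrow> 'a \<Rightarrow> 'k) \<Rightarrow> ('a \<Rightarrow> 'a) \<Rightarrow> 'a \<Rightarrow> 'a \<Rightarrow> 'a \<Rightarrow> 'a"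
where
  "U_op s dN sharp unt x y = s (trace_form dN unt x y) x - polar sharp (sharp x) y"

text \<open>The following notions are those of a unital quadratic Jordan algebra \<open>(U, unt)\<close>.\<close>

definition nondegenerate_jordan :: "('a::ab_group_add \<Rightarrow> 'a \<Rightarrow> 'a) \<Rightarrow> bool" where
  "nondegenerate_jordan U \<longleftrightarrow> (\<forall>x. (\<forall>y. U x y = 0) \<longrightarrow> x = 0)"

definition jordan_ideal ::
  "('k::field \<Rightarrow> 'a::ab_group_add \<Rightarrow> 'a) \<Rightarrow> ('a \<Rightarrow> 'a \<Rightarrow> 'a) \<Rightarrow> 'a set \<Rightarrow> bool"
where
  "jordan_ideal s U I \<longleftrightarrow>
     module.subspace s I \<and> (\<forall>x\<in>I. \<forall>y. U x y \<in> I) \<and> (\<forall>x. \<forall>y\<in>I. U x y \<in> I)"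

definition simple_jordan ::
  "('k::field \<Rightarrow> 'a::ab_group_add \<Rightarrow> 'a) \<Rightarrow> ('a \<Rightarrow> 'a \<Rightarrow> 'a) \<Rightarrow> bool"
where
  "simple_jordan s U \<longleftrightarrow>
     (\<exists>x y. U x y \<noteq> 0) \<and> (\<forall>I. jordan_ideal s U I \<longrightarrow> I = {0} \<or> I = UNIV)"

definition idempotent :: "('a::ab_group_add \<Rightarrow> 'a \<Rightarrow> 'a) \<Rightarrow> 'a \<Rightarrow> 'a \<Rightarrow> bool" where
  "idempotent U unt f \<longleftrightarrow> U f unt = f"

text \<open>\<open>polar (\<lambda>w. U w unt) f g\<close> is the circle product of \<open>f\<close> and \<open>g\<close>.\<close>

definition orthogonal_idempotents ::
  "('a::ab_group_add \<Rightarrow> 'a \<Rightarrow> 'a) \<Rightarrow> 'a \<Rightarrow> 'a \<Rightarrow> 'a \<Rightarrow> bool"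
where
  "orthogonal_idempotents U unt f g \<longleftrightarrow> idempotent U unt f \<and> idempotent U unt g \<and>
     U f g = 0 \<and> U g f = 0 \<and> polar (\<lambda>w. U w unt) f g = 0"

definition primitive_idempotent ::
  "('a::ab_group_add \<Rightarrow> 'a \<Rightarrow> 'a) \<Rightarrow> 'a \<Rightarrow> 'a \<Rightarrow> bool"
where
  "primitive_idempotent U unt f \<longleftrightarrow> idempotent U unt f \<and> f \<noteq> 0 \<and>
     (\<forall>g h. orthogonal_idempotents U unt g h \<longrightarrow> f = g + h \<longrightarrow> g = 0 \<or> h = 0)"


section \<open>The discriminant of a pair of trace zero elements\<close>

definition disc_D :: "'k::field \<Rightarrow> 'k \<Rightarrow> 'k \<Rightarrow> 'k \<Rightarrow> 'k \<Rightarrow> 'k \<Rightarrow> 'k \<Rightarrow> 'k \<Rightarrow> 'k" where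
  "disc_D N1 N2 S1 S2 T11 T12 T21 T22 =
     27 * N1^2 * N2^2 + 4 * N1^2 * S2^3 + 4 * N2^2 * S1^3 + 6 * N1 * N2 * S1 * S2 * T11
     - S1^2 * S2^2 * T11^2 + 4 * N1 * N2 * T11^3 + 4 * N1 * S1 * S2^2 * T12
     + 4 * N2 * S1^2 * S2 * T21 + 4 * N1 * S2^2 * T11 * T21 + 4 * N2 * S1^2 * T11 * T12
     + 4 * N1 * S2 * T11^2 * T12 + 4 * N2 * S1 * T11^2 * T21 - 18 * N1 * N2 * T12 * T21
     - 18 * N1 * N2 * T11 * T22 - T12^2 * T21^2 + 4 * N1 * T12^3 + 4 * N2 * T21^3
     + 4 * S1^2 * S2^2 * T22 + 2 * S1 * S2 * T11 * T12 * T21 + 2 * S1 * S2 * T11^2 * T22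
     - 12 * N1 * S2 * T12 * T22 - 12 * N2 * S1 * T21 * T22 + 2 * T11 * T12 * T21 * T22
     + 4 * S1 * T12^2 * T22 + 4 * S2 * T21^2 * T22 - 8 * S1 * S2 * T22^2 - T11^2 * T22^2
     + 4 * T22^3"

text \<open>
  In the coordinate formula for the sharp map the nine equations are normalised as
  \<open>ad p\<^sub>2 = F\<^sub>1\<close>, \<open>ad p\<^sub>4 = F\<^sub>2\<close>, ..., \<open>-(ad u\<^sub>1 + t\<^sub>1 ad p\<^sub>2) = F\<^sub>5\<close>, ....
  The printed source has an extra factor 3 on each left-hand side. With that factor the formula
  is false in every characteristic other than 2 (where 3 = 1): for \<open>x = \<sigma>\<^sub>3 = unt\<close> the
  axioms give \<open>sharp unt = unt\<close>, so \<open>ad s\<^sub>3 = 1\<close> and \<open>ad\<close> vanishes in the other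
  coordinates, while \<open>F\<^sub>9 = s\<^sub>3^2 = 1\<close> and the other \<open>F\<^sub>i\<close> vanish.
\<close>

end

theory Submission
  imports Defs
begin

text \<open>
  Write \<open>x\<close>, \<open>y\<close>, \<open>u\<close> for \<open>\<sigma>\<close>, \<open>\<upsilon>\<^sub>1\<close>, \<open>\<upsilon>\<^sub>2\<close>, and \<open>a \<diamondop> b\<close> for the polarisation of \<open>sharp\<close>.
  The coordinate formula is a multiplication table in disguise, and the proof is organised
  around the table of the nine elements
  \<open>1, x, x\<^sup>#, y, y\<^sup>#, x \<diamondop> y, x \<diamondop> y\<^sup>#, x\<^sup># \<diamondop> y, x\<^sup># \<diamondop> y\<^sup>#\<close>, where \<open>a\<^sup>#\<close> is \<open>sharp a\<close>.

  The table. The adjoint identity \<open>(a\<^sup>#)\<^sup># = N(a) a\<close> has degree 4, so over a small field its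
  values do not determine its linearisations. It holds over the rational function field
  \<open>k(t)\<close> too; evaluated at \<open>a + t b\<close>, its coefficients of \<open>t\<close> and \<open>t\<^sup>2\<close> are the two
  linearisations that are needed (\<open>cubic_jordan_algebra_identities\<close>). Together with the
  symmetry of the trilinear form \<open>T(a \<diamondop> b, c)\<close> and the nondegeneracy of \<open>T\<close> they give every
  product of two of the nine elements as a combination of the nine, with coefficients that
  are integral polynomials in \<open>N(x)\<close>, \<open>N(y)\<close>, \<open>S(x)\<close>, \<open>S(y)\<close> and the four traces \<open>T\<close> of
  \<open>x, x\<^sup>#\<close> against \<open>y, y\<^sup>#\<close> (\<open>sharp_lin\<close>). Of \<open>(x \<diamondop> y) \<diamondop> (x\<^sup># \<diamondop> y\<^sup>#)\<close> and
  \<open>(x \<diamondop> y\<^sup>#) \<diamondop> (x\<^sup># \<diamondop> y)\<close> the linearisation gives only the sum. In the first one \<open>x\<^sup># \<diamondop> y\<^sup>#\<close>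
  is, up to multiples of \<open>x\<close> and \<open>y\<close>, the element \<open>- (x \<diamondop> y)\<^sup>#\<close>, and \<open>a \<diamondop> a\<^sup>#\<close> is known for
  every \<open>a\<close>.

  Independence. The Gram matrix \<open>G\<close> of \<open>T\<close> on the nine elements is polynomial in the same
  eight parameters. Its determinant is the cube of the discriminant \<open>D\<close>, but already
  \<open>D G\<^sup>-\<^sup>1\<close> has polynomial entries, and few of them. So if a combination \<open>w\<close> of the nine
  elements vanishes, the nine relations \<open>T(w, e) = 0\<close> combine to \<open>D c = 0\<close> for each
  coefficient \<open>c\<close> (\<open>discriminant_rows\<close>, \<open>lin_eq_0_iff\<close>).

  Change of basis. Since \<open>y\<^sup># = t\<^sub>1\<^sub>3\<^sub>6 y - t\<^sub>1\<^sub>3\<^sub>5 u + S(y)/3\<close>, independence forces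
  \<open>t\<^sub>1\<^sub>3\<^sub>5 \<noteq> 0\<close>, and comparing two expressions for \<open>(t\<^sub>1\<^sub>3\<^sub>5 u)\<^sup>#\<close> expresses \<open>S(y)\<close> and
  \<open>N(y)\<close> through the parameters \<open>t\<close>. Multiplying a combination of the adapted basis by
  \<open>t\<^sub>1\<^sub>3\<^sub>5\<close> gives it polynomial coordinates in the nine elements, hence the asserted formula
  for \<open>sharp\<close> becomes nine polynomial identities in free variables
  (\<open>sharp_coordinates_polynomial\<close>). The same multiplication shows that the adapted elements
  are independent, so they form a basis in dimension 9 and coordinates may be compared,
  which is the equivalence claimed.
\<close>

section \<open>Quadratic maps and cubic forms\<close>

lemma polar_commute: "polar q x y = polar q y x"
  by (simp add: polar_def add.commute)

lemma quadratic_map_scale: "quadratic_map s1 s2 q \<Longrightarrow> q (s1 c x) = s2 (c\<^sup>2) (q x)"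
  by (simp add: quadratic_map_def)

lemma quadratic_map_add: "q (x + y) = q x + q y + polar q x y"
  by (simp add: polar_def)

lemma
  assumes "quadratic_map s1 s2 q"
  shows polar_add_right: "polar q x (y + z) = polar q x y + polar q x z"
    and polar_scale_right: "polar q x (s1 c y) = s2 c (polar q x y)"
    and polar_add_left: "polar q (x + y) z = polar q x z + polar q y z"
    and polar_scale_left: "polar q (s1 c x) y = s2 c (polar q x y)"
proof -
  have lin: "Vector_Spaces.linear s1 s2 (polar q x)" for x
    using assms by (simp add: quadratic_map_def)
  show add: "polar q x (y + z) = polar q x y + polar q x z"
    and scale: "polar q x (s1 c y) = s2 c (polar q x y)" for x y z c
    using lin[of x] by (simp_all add: Vector_Spaces.linear_iff)
  show "polar q (x + y) z = polar q x z + polar q y z" "polar q (s1 c x) y = s2 c (polar q x y)"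
    using add[of z x y] scale[of y c x] by (metis polar_commute)+
qed

lemma polar_zero_right [simp]: "quadratic_map s1 s2 q \<Longrightarrow> polar q x 0 = 0"
  using polar_add_right[of s1 s2 q x 0 0] by simp

lemma polar_zero_left [simp]: "quadratic_map s1 s2 q \<Longrightarrow> polar q 0 x = 0"
  by (metis polar_commute polar_zero_right)

lemma quadratic_map_zero [simp]: 
  assumes "quadratic_map s1 s2 q" shows "q 0 = 0"
  using polar_zero_right[OF assms, of 0] by (simp add: polar_def)

lemma polar_self:
  assumes "quadratic_map s1 (*) q" shows "polar q x x = 2 * q x"
proof -
  have "vector_space s1"
    using assms by (auto simp: quadratic_map_def Vector_Spaces.linear_iff)
  then have "s1 (1 + 1) x = x + x"
    by (simp only: vector_space.vector_space_assms(2,4))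
  then show ?thesis
    using quadratic_map_scale[OF assms, of 2 x] by (simp add: polar_def)
qed

lemma polar_sum_left:
  "quadratic_map s1 s2 q \<Longrightarrow> polar q (\<Sum>i\<in>A. s1 (c i) (f i)) y = (\<Sum>i\<in>A. s2 (c i) (polar q (f i) y))"
  by (induction A rule: infinite_finite_induct) (simp_all add: polar_add_left polar_scale_left)

lemma
  assumes "cubic_form s N dN"
  shows cubic_form_scale: "N (s c x) = c ^ 3 * N x"
    and cubic_form_add: "N (x + y) = N x + dN x y + dN y x + N y"
    and cubic_form_self: "dN x x = 3 * N x"
    and cubic_form_linear: "Vector_Spaces.linear s (*) (dN x)"
    and cubic_form_quadratic: "quadratic_map s (*) (\<lambda>x. dN x y)"
  using assms by (simp_all add: cubic_form_def)

lemma
  assumes "cubic_form s N dN"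
  shows cubic_form_add_right: "dN x (y + z) = dN x y + dN x z"
    and cubic_form_scale_right: "dN x (s c y) = c * dN x y"
  using cubic_form_linear[OF assms] by (simp_all add: Vector_Spaces.linear_iff)

lemma d2N_commute: "d2N dN x y z = d2N dN y x z"
  by (simp add: d2N_def polar_commute)

lemma cubic_form_add_left: "dN (x + y) z = dN x z + dN y z + d2N dN x y z"
  by (simp add: d2N_def polar_def)

text \<open>
  Expanding \<open>N\<close> on \<open>(x + y) + z\<close> and on \<open>x + (y + z)\<close> leaves exactly the two trilinear
  terms. With the evident symmetry in the first two arguments this makes \<open>d2N\<close> totally
  symmetric.
\<close>

lemma d2N_rotate:
  assumes "cubic_form s N dN"
  shows "d2N dN x y z = d2N dN y z x"
proof -
  have "N (x + y + z) = N (x + (y + z))" by (simp add: add.assoc)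
  then show ?thesis
    by (simp add: cubic_form_add[OF assms] cubic_form_add_left[of dN] cubic_form_add_right[OF
        assms])
qed

lemma d2N_swap:
  assumes "cubic_form s N dN"
  shows "d2N dN x y z = d2N dN x z y"
  by (metis d2N_rotate[OF assms] d2N_commute)

lemma
  assumes "cubic_form s N dN"
  shows d2N_add_left: "d2N dN (x + x') y z = d2N dN x y z + d2N dN x' y z"
    and d2N_scale_left: "d2N dN (s c x) y z = c * d2N dN x y z"
  unfolding d2N_def
  by (simp_all add: polar_add_left[OF cubic_form_quadratic[OF assms]]
      polar_scale_left[OF cubic_form_quadratic[OF assms]])

lemma d2N_self:
  assumes "cubic_form s N dN"
  shows "d2N dN x x y = 2 * dN x y"
  unfolding d2N_def by (rule polar_self[OF cubic_form_quadratic[OF assms]])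

lemma cubic_form_zero:
  assumes "cubic_form s N dN"
  shows "N 0 = 0" "dN x 0 = 0" "dN 0 x = 0"
proof -
  show right: "dN x 0 = 0" for x
    using cubic_form_add_right[OF assms, of x 0 0] by (metis add_0 add_cancel_right_right)
  show "dN 0 x = 0"
    by (rule quadratic_map_zero[OF cubic_form_quadratic[OF assms]])
  show "N 0 = 0"
    using cubic_form_add[OF assms, of 0 0] right[of 0] by (metis add_0 add_cancel_right_right
        add.right_neutral)
qed

lemma cubic_form_sum_right:
  assumes "cubic_form s N dN"
  shows "dN x (\<Sum>i\<in>A. s (c i) (f i)) = (\<Sum>i\<in>A. c i * dN x (f i))"
  by (induction A rule: infinite_finite_induct)
    (simp_all add: cubic_form_zero[OF assms] cubic_form_add_right[OF assms]
        cubic_form_scale_right[OF assms])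

lemma sum_off_diagonal_Suc:
  "(\<Sum>i<Suc n. \<Sum>j\<in>{..<Suc n} - {i}. f i j) =
   (\<Sum>i<n. \<Sum>j\<in>{..<n} - {i}. f i j) + (\<Sum>i<n. f i n) + (\<Sum>j<n. f n j :: 'a::comm_monoid_add)"
proof -
  have "(\<Sum>j\<in>{..<Suc n} - {i}. f i j) = (\<Sum>j\<in>{..<n} - {i}. f i j) + f i n" if "i < n" for i
  proof -
    have "{..<Suc n} - {i} = insert n ({..<n} - {i})" using that by auto
    then show ?thesis by (simp add: add.commute)
  qed
  moreover have "{..<Suc n} - {n} = {..<n}" by auto
  ultimately show ?thesis by (simp add: sum.distrib)
qed

section \<open>Extension of scalars\<close>

text \<open>
  The scalar extensions range over ring structures carried by sets. This is the one whose
  carrier is a whole field type; it turns the ring sums in the extended forms into ordinary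
  sums.
\<close>

definition field_ring :: "'a::field ring" where
  "field_ring = \<lparr>carrier = UNIV, monoid.mult = (*), one = 1, zero = 0, ring.add = (+)\<rparr>"

lemma field_ring_simps [simp]:
  "carrier field_ring = UNIV" "monoid.mult field_ring = (*)" "one field_ring = 1"
  "zero field_ring = 0" "ring.add field_ring = (+)"
  by (simp_all add: field_ring_def)

lemma field_field_ring: "field (field_ring :: 'a::field ring)"
proof -
  have ab: "abelian_group (field_ring :: 'a ring)"
    by (rule abelian_groupI) (auto simp: algebra_simps intro: exI[of _ "- _"] left_minus)
  have cr: "cring (field_ring :: 'a ring)"
    by (rule cringI[OF ab]) (auto simp: algebra_simps intro!: comm_monoidI)
  show ?thesis
  proof (rule cring.cring_fieldI2[OF cr])
    fix a :: 'a assume "a \<in> carrier field_ring" "a \<noteq> \<zero>\<^bsub>field_ring\<^esub>"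
    then show "\<exists>b\<in>carrier field_ring. a \<otimes>\<^bsub>field_ring\<^esub> b = \<one>\<^bsub>field_ring\<^esub>"
      by (auto intro!: exI[of _ "inverse a"])
  qed simp
qed

lemma finsum_field_ring [simp]:
  "finite A \<Longrightarrow> finsum (field_ring :: 'a::field ring) f A = sum f A"
proof (induction A rule: finite_induct)
  interpret field "field_ring :: 'a ring" by (rule field_field_ring)
  case empty show ?case by simp
next
  interpret field "field_ring :: 'a ring" by (rule field_field_ring)
  case (insert x A) then show ?case by (subst finsum_insert) auto
qed

lemma minus_field_ring [simp]: "a \<ominus>\<^bsub>field_ring\<^esub> b = a - (b :: 'a::field)"
proof -
  interpret field "field_ring :: 'a ring" by (rule field_field_ring)
  have "\<ominus>\<^bsub>field_ring\<^esub> b = - b" by (rule minus_equality) auto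
  then show ?thesis by (simp add: minus_eq)
qed

context
  fixes h :: "'k::field \<Rightarrow> 'l::field"
  assumes h_add: "h (a + b) = h a + h b" and h_mult: "h (a * b) = h a * h b" and h_one: "h 1 = 1"
begin

lemma h_zero: "h 0 = 0"
  by (metis h_add add_0 add_cancel_right_right)

lemma h_numerals: "h 2 = 2" "h 3 = 3"
  using h_add[of 1 1] h_add[of 1 2] by (simp_all add: h_one)

lemma h_sum: "h (sum f A) = (\<Sum>x\<in>A. h (f x))"
  by (induction A rule: infinite_finite_induct) (simp_all add: h_zero h_add)

lemma h_power: "h (a ^ n) = h a ^ n"
  by (induction n) (simp_all add: h_one h_mult)

lemma quadratic_combination_step:
  fixes a b c qx qy qz qe Bxy Bxz Byz Bx By Bz k l m :: "'l"
  shows "a\<^sup>2 * qx + b\<^sup>2 * qy + c\<^sup>2 * qz + a * b * Bxy + a * c * Bxz + b * c * Byz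
      + qe * (a * k + b * l + c * m)\<^sup>2 + (a * Bx + b * By + c * Bz) * (a * k + b * l + c * m)
    = a\<^sup>2 * (qx + k\<^sup>2 * qe + k * Bx) + b\<^sup>2 * (qy + l\<^sup>2 * qe + l * By) + c\<^sup>2 * (qz + m\<^sup>2 * qe
        + m * Bz)
      + a * b * (Bxy + l * Bx + k * By + k * l * (2 * qe))
      + a * c * (Bxz + m * Bx + k * Bz + k * m * (2 * qe))
      + b * c * (Byz + m * By + l * Bz + l * m * (2 * qe))"
  by Groebner_Basis.algebra

text \<open>
  The extension of a quadratic form is defined from its values on a basis. On a combination
  of three vectors of the ground space with extended coefficients it takes the value that
  the polarisation formula predicts. Three vectors are needed because \<open>sharp (x + t y)\<close>
  involves \<open>1\<close>, \<open>t\<close> and \<open>t\<^sup>2\<close>, and \<open>sharp\<close> is applied to it once more. The induction adds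
  one basis vector at a time.
\<close>

lemma ext_quad_combination:
  fixes s :: "'k \<Rightarrow> 'a::ab_group_add \<Rightarrow> 'a" and e :: "nat \<Rightarrow> 'a"
  assumes q: "quadratic_map s (*) q"
  assumes X: "\<And>i. i < n \<Longrightarrow> X i = a * h (\<xi> i) + b * h (\<eta> i) + c * h (\<zeta> i)"
    and x: "x = (\<Sum>i<n. s (\<xi> i) (e i))" and y: "y = (\<Sum>i<n. s (\<eta> i) (e i))"
    and z: "z = (\<Sum>i<n. s (\<zeta> i) (e i))"
  shows "ext_quad field_ring h n e q X =
    a\<^sup>2 * h (q x) + b\<^sup>2 * h (q y) + c\<^sup>2 * h (q z)
    + a * b * h (polar q x y) + a * c * h (polar q x z) + b * c * h (polar q y z)"
  using X x y z
proof (induction n arbitrary: x y z)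
  case 0
  then show ?case by (simp add: ext_quad_def quadratic_map_zero[OF q] polar_zero_left[OF q] h_zero)
next
  case (Suc n)
  define x' where "x' = (\<Sum>i<n. s (\<xi> i) (e i))"
  define y' where "y' = (\<Sum>i<n. s (\<eta> i) (e i))"
  define z' where "z' = (\<Sum>i<n. s (\<zeta> i) (e i))"
  have IH: "ext_quad field_ring h n e q X =
    a\<^sup>2 * h (q x') + b\<^sup>2 * h (q y') + c\<^sup>2 * h (q z')
    + a * b * h (polar q x' y') + a * c * h (polar q x' z') + b * c * h (polar q y' z')"
    using Suc by (simp add: x'_def y'_def z'_def)
  have pol: "(\<Sum>i<n. h (polar q (e i) (e n)) * X i) =
      a * h (polar q x' (e n)) + b * h (polar q y' (e n)) + c * h (polar q z' (e n))"
    using Suc.prems(1)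
    by (simp add: x'_def y'_def z'_def polar_sum_left[OF q] h_sum h_mult sum_distrib_left
        algebra_simps sum.distrib)
  have rec: "ext_quad field_ring h (Suc n) e q X = ext_quad field_ring h n e q X
      + h (q (e n)) * (X n)\<^sup>2 + (\<Sum>i<n. h (polar q (e i) (e n)) * X i) * X n"
    by (simp add: ext_quad_def sum_distrib_right power2_eq_square) (simp add: ac_simps)
  have Xn: "X n = a * h (\<xi> n) + b * h (\<eta> n) + c * h (\<zeta> n)"
    using Suc.prems by simp
  have xyz: "x = x' + s (\<xi> n) (e n)" "y = y' + s (\<eta> n) (e n)" "z = z' + s (\<zeta> n) (e n)"
    using Suc.prems by (simp_all add: x'_def y'_def z'_def)
  have quad: "h (q (u + s k (e n))) = h (q u) + (h k)\<^sup>2 * h (q (e n))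
      + h k * h (polar q u (e n))" for u k
    by (simp add: quadratic_map_add[of q u] quadratic_map_scale[OF q] polar_scale_right[OF q] h_add
        h_mult h_power)
  have polar: "h (polar q (u + s k (e n)) (v + s l (e n))) =
      h (polar q u v) + h l * h (polar q u (e n)) + h k * h (polar q v (e n))
          + h k * h l * (2 * h (q (e n)))"
    for u v k l
    using polar_commute[of q "e n" v]
    by (simp add: polar_add_left[OF q] polar_add_right[OF q] polar_self[OF q]
        polar_scale_left[OF q] polar_scale_right[OF q] h_add h_mult h_numerals algebra_simps)
  show ?case
    unfolding rec IH pol Xn xyz quad polar by (rule quadratic_combination_step)
qed

lemma cubic_combination_step:
  fixes t Nx Ny Ne Dxy Dyx Dxe Dye Dex Dey Dxye k l :: "'l"
  shows "Nx + t * Dxy + t\<^sup>2 * Dyx + t ^ 3 * Ny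
      + (Dxe + t\<^sup>2 * Dye + t * Dxye) * (k + t * l)
      + (Dex + t * Dey) * (k + t * l)\<^sup>2 + Ne * (k + t * l) ^ 3
    = (Nx + k * Dxe + k\<^sup>2 * Dex + k ^ 3 * Ne)
      + t * (Dxy + l * Dxe + k\<^sup>2 * Dey + k\<^sup>2 * l * (3 * Ne) + k * Dxye + k * l * (2 * Dex))
      + t\<^sup>2 * (Dyx + k * Dye + l\<^sup>2 * Dex + l\<^sup>2 * k * (3 * Ne) + l * Dxye + l * k * (2 * Dey))
      + t ^ 3 * (Ny + l * Dye + l\<^sup>2 * Dey + l ^ 3 * Ne)"
  by Groebner_Basis.algebra

text \<open>
  The same for cubic forms on a line through two ground vectors. Splitting off the last
  coordinate \<open>X n\<close>, the part of the extended cubic form that is linear in it is the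
  extension of the quadratic form \<open>w \<mapsto> dN w (e n)\<close>, so the previous lemma applies in the
  induction step.
\<close>

lemma ext_cubic_combination:
  fixes s :: "'k \<Rightarrow> 'a::ab_group_add \<Rightarrow> 'a" and e :: "nat \<Rightarrow> 'a"
  assumes N: "cubic_form s N dN"
  assumes X: "\<And>i. i < n \<Longrightarrow> X i = h (\<xi> i) + t * h (\<eta> i)"
    and x: "x = (\<Sum>i<n. s (\<xi> i) (e i))" and y: "y = (\<Sum>i<n. s (\<eta> i) (e i))"
  shows "ext_cubic field_ring h n e N dN X =
    h (N x) + t * h (dN x y) + t\<^sup>2 * h (dN y x) + t ^ 3 * h (N y)"
  using X x y
proof (induction n arbitrary: x y)
  case 0
  then show ?case by (simp add: ext_cubic_def cubic_form_zero[OF N] h_zero)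
next
  case (Suc n)
  note q = cubic_form_quadratic[OF N]
  define x' where "x' = (\<Sum>i<n. s (\<xi> i) (e i))"
  define y' where "y' = (\<Sum>i<n. s (\<eta> i) (e i))"
  have IH: "ext_cubic field_ring h n e N dN X =
    h (N x') + t * h (dN x' y') + t\<^sup>2 * h (dN y' x') + t ^ 3 * h (N y')"
    using Suc by (simp add: x'_def y'_def)
  have quad: "ext_quad field_ring h n e (\<lambda>w. dN w (e n)) X =
      h (dN x' (e n)) + t\<^sup>2 * h (dN y' (e n)) + t * h (d2N dN x' y' (e n))"
    using ext_quad_combination[OF q, of n X 1 \<xi> t \<eta> 0 \<xi> x' e y' x' "e n"] Suc.prems(1)
    by (simp add: x'_def y'_def d2N_def)
  have lin: "(\<Sum>i<n. h (dN (e n) (e i)) * X i) = h (dN (e n) x') + t * h (dN (e n) y')"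
    using Suc.prems(1)
    by (simp add: x'_def y'_def cubic_form_sum_right[OF N] h_sum h_mult sum_distrib_left
        algebra_simps sum.distrib)
  have rec: "ext_cubic field_ring h (Suc n) e N dN X = ext_cubic field_ring h n e N dN X
      + ext_quad field_ring h n e (\<lambda>w. dN w (e n)) X * X n
      + (\<Sum>i<n. h (dN (e n) (e i)) * X i) * (X n)\<^sup>2 + h (N (e n)) * (X n) ^ 3"
    unfolding ext_cubic_def ext_quad_def d2N_def
    by (simp add: sum_off_diagonal_Suc sum_distrib_right power2_eq_square power3_eq_cube
        distrib_right del: sum.lessThan_Suc)
      (simp add: ac_simps)
  have Xn: "X n = h (\<xi> n) + t * h (\<eta> n)"
    using Suc.prems by simp
  have xy: "x = x' + s (\<xi> n) (e n)" "y = y' + s (\<eta> n) (e n)"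
    using Suc.prems by (simp_all add: x'_def y'_def)
  have NN: "h (N (u + s k (e n))) = h (N u) + h k * h (dN u (e n)) + (h k)\<^sup>2 * h (dN (e n) u)
      + h k ^ 3 * h (N (e n))" for u k
    by (simp add: cubic_form_add[OF N] cubic_form_scale[OF N] cubic_form_scale_right[OF N]
        quadratic_map_scale[OF q] h_add h_mult h_power)
  have mixed: "d2N dN u (s k (e n)) w = k * d2N dN u w (e n)" for u k w
    by (metis d2N_commute d2N_scale_left[OF N] d2N_swap[OF N])
  have mixed_self: "d2N dN u (e n) (e n) = 2 * dN (e n) u" for u
    by (metis d2N_rotate[OF N] d2N_self[OF N])
  have dNN: "h (dN (u + s k (e n)) (v + s l (e n))) =
      h (dN u v) + h l * h (dN u (e n)) + (h k)\<^sup>2 * h (dN (e n) v)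
          + (h k)\<^sup>2 * h l * (3 * h (N (e n)))
      + h k * h (d2N dN u v (e n)) + h k * h l * (2 * h (dN (e n) u))"
    for u v k l
    by (simp add: cubic_form_add_left[of dN] cubic_form_add_right[OF N] mixed mixed_self
        cubic_form_scale_right[OF N] cubic_form_self[OF N]
        quadratic_map_scale[OF q] h_add h_mult h_numerals h_power algebra_simps)
  have comm: "d2N dN y' x' (e n) = d2N dN x' y' (e n)" by (rule d2N_commute)
  show ?case
    unfolding rec IH quad lin Xn xy NN dNN comm by (rule cubic_combination_step)
qed

end

section \<open>The identities of a cubic Jordan algebra and their linearizations\<close>

text \<open>
  An element of \<open>k(t)\<close> presented as a polynomial in \<open>t\<close> remembers its coefficients.
\<close>

lemma Fract_poly4:
  fixes c0 c1 c2 c3 c4 :: "'k::field"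
  defines "h \<equiv> \<lambda>c. Fract [:c:] 1" and "t \<equiv> Fract [:0, 1:] 1"
  shows "h c0 + t * h c1 + t\<^sup>2 * h c2 + t ^ 3 * h c3 + t ^ 4 * h c4 = Fract [:c0, c1, c2, c3, c4:]
      1"
  by (simp add: h_def t_def numeral_eq_Suc)

lemma (in vector_space) coord_combination:
  assumes "ordered_basis scale n e"
  shows "(\<Sum>i<n. scale (coord scale n e i x) (e i)) = x"
proof -
  have "(\<Sum>b\<in>e ` {..<n}. scale (representation (e ` {..<n}) x b) b) = x"
    using assms by (intro sum_representation_eq) (auto simp: ordered_basis_def)
  then show ?thesis
    using assms by (simp add: sum.reindex ordered_basis_def coord_def)
qed

lemma (in vector_space)
  assumes "ordered_basis scale n e"
  shows coord_add: "coord scale n e m (x + y) = coord scale n e m x + coord scale n e m y"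
    and coord_diff: "coord scale n e m (x - y) = coord scale n e m x - coord scale n e m y"
    and coord_scale: "coord scale n e m (scale c x) = c * coord scale n e m x"
  using assms
  by (simp_all add: ordered_basis_def coord_def representation_add representation_diff
      representation_scale)

lemma (in vector_space) coord_eqI:
  assumes "ordered_basis scale n e" "\<And>m. m < n \<Longrightarrow> coord scale n e m x = coord scale n e m y"
  shows "x = y"
proof -
  have "x = (\<Sum>i<n. scale (coord scale n e i x) (e i))"
    by (rule coord_combination[OF assms(1), symmetric])
  also have "\<dots> = (\<Sum>i<n. scale (coord scale n e i y) (e i))"
    using assms(2) by simp
  also have "\<dots> = y" by (rule coord_combination[OF assms(1)])
  finally show ?thesis .
qed

lemma trace_form_commute:
  assumes "cubic_form s N dN"
  shows "trace_form dN unt x y = trace_form dN unt y x"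
  by (simp add: trace_form_def d2N_swap[OF assms, of _ x y])

lemma
  assumes "cubic_form s N dN"
  shows trace_form_add_left: "trace_form dN unt (x + x') y = trace_form dN unt x y
      + trace_form dN unt x' y"
    and trace_form_scale_left: "trace_form dN unt (s c x) y = c * trace_form dN unt x y"
  by (simp_all add: trace_form_def cubic_form_add_right[OF assms] cubic_form_scale_right[OF assms]
      d2N_add_left[OF assms] d2N_scale_left[OF assms] d2N_commute[of dN unt] algebra_simps)

lemma trace_form_sum_left:
  assumes "cubic_form s N dN"
  shows "trace_form dN unt (\<Sum>i\<in>A. s (c i) (f i)) y = (\<Sum>i\<in>A. c i * trace_form dN unt (f i) y)"
proof -
  have "trace_form dN unt 0 y = 0"
    using trace_form_add_left[OF assms, of unt 0 0 y] by (metis add_0 add_cancel_right_right)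
  then show ?thesis
    by (induction A rule: infinite_finite_induct)
      (simp_all add: trace_form_add_left[OF assms] trace_form_scale_left[OF assms])
qed

text \<open>
  The adjoint identity at the point \<open>x + t y\<close> over \<open>k(t)\<close>: the coefficients of \<open>1\<close>, \<open>t\<close>,
  \<open>t\<^sup>2\<close> are the first three identities. Over a field with few elements they do not follow in
  general from the values of the adjoint identity on the ground space. The last two
  identities only involve ground vectors.
\<close>

theorem cubic_jordan_algebra_identities:
  assumes J: "cubic_jordan_algebra s N dN sharp unt"
  shows "sharp (sharp x) = s (N x) x" (is ?A1)
    and "polar sharp (sharp x) (polar sharp x y) = s (N x) y + s (dN x y) x" (is ?A2)
    and "polar sharp (sharp x) (sharp y) + sharp (polar sharp x y) = s (dN x y) y
        + s (dN y x) x" (is ?A3)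
    and "dN x y = trace_form dN unt (sharp x) y" (is ?D)
    and "polar sharp unt y = s (trace_form dN unt y unt) unt - y" (is ?U)
proof -
  interpret vector_space s using J by (simp add: cubic_jordan_algebra_def)
  define h :: "'a \<Rightarrow> 'a poly fract" where "h = (\<lambda>c. Fract [:c:] 1)"
  define t :: "'a poly fract" where "t = Fract [:0, 1:] 1"
  have h: "h (a + b) = h a + h b" "h (a * b) = h a * h b" "h 1 = 1" for a b
    by (simp_all add: h_def One_fract_def one_pCons mult.commute)
  have h_diff: "h (a - b) = h a - h b" for a b
    by (simp add: h_def)
  have h_inj: "h a = h b \<longleftrightarrow> a = b" for a b
    by (simp add: h_def eq_fract)
  have "field_extension field_ring h"
    unfolding field_extension_def field_ring_def[symmetric]
    by (auto simp: field_field_ring h intro!: ring_hom_memI)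
  then obtain n e where e: "ordered_basis s n e"
    and ids: "cubic_identities field_ring h s n e N dN sharp unt"
    using J by (auto simp: cubic_jordan_algebra_def)
  have N: "cubic_form s N dN" and sharp: "quadratic_map s s sharp"
    using J by (simp_all add: cubic_jordan_algebra_def)
  let ?c = "coord s n e" and ?sh = "ext_sharp field_ring h s n e sharp"
  note comb = coord_combination[OF e, symmetric]
  note c_simps = coord_add[OF e] coord_diff[OF e] coord_scale[OF e]

  have c_polar: "polar (\<lambda>w. ?c m (sharp w)) x y = ?c m (polar sharp x y)" for m x y
    by (simp add: polar_def c_simps)
  have c_sharp: "quadratic_map s (*) (\<lambda>w. ?c m (sharp w))" for m
    using sharp cubic_form_linear[OF N]
    by (auto simp: quadratic_map_def Vector_Spaces.linear_iff c_simps c_polar)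
  have sh: "?sh X m = a\<^sup>2 * h (?c m (sharp x)) + b\<^sup>2 * h (?c m (sharp y)) + c\<^sup>2 * h (?c m (sharp z))
      + a * b * h (?c m (polar sharp x y)) + a * c * h (?c m (polar sharp x z))
      + b * c * h (?c m (polar sharp y z))"
    if "m < n" "\<And>i. i < n \<Longrightarrow> X i = a * h (?c i x) + b * h (?c i y) + c * h (?c i z)"
    for X a b c x y z m
    using ext_quad_combination[OF h c_sharp[of m] that(2) comb comb comb] that(1)
    by (simp add: ext_sharp_def c_polar)

  have A: "?c m (sharp (sharp x)) = N x * ?c m x \<and>
    ?c m (polar sharp (sharp x) (polar sharp x y)) = N x * ?c m y + dN x y * ?c m x \<and>
    ?c m (polar sharp (sharp x) (sharp y) + sharp (polar sharp x y)) = dN x y * ?c m y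
        + dN y x * ?c m x"
    if m: "m < n" for m
  proof -
    \<comment> \<open>the point \<open>x + t y\<close> of the extended space\<close>
    define X where "X = (\<lambda>i\<in>{..<n}. h (?c i x) + t * h (?c i y))"
    have "?sh (?sh X) m = ext_cubic field_ring h n e N dN X * X m"
      using ids m by (auto simp: cubic_identities_def Let_def X_def)
    moreover have "ext_cubic field_ring h n e N dN X
        = h (N x) + t * h (dN x y) + t\<^sup>2 * h (dN y x) + t ^ 3 * h (N y)"
      by (rule ext_cubic_combination[OF h N _ comb comb]) (simp add: X_def)
    moreover have "?sh X i = 1 * h (?c i (sharp x)) + t * h (?c i (polar sharp x y))
        + t\<^sup>2 * h (?c i (sharp y))"
      if "i < n" for i
      by (subst sh[OF that, where a = 1 and b = t and c = 0 and x = x and y = y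
          and z = x]) (auto simp: X_def)
    then have "?sh (?sh X) m = 1\<^sup>2 * h (?c m (sharp (sharp x)))
        + t\<^sup>2 * h (?c m (sharp (polar sharp x y)))
      + (t\<^sup>2)\<^sup>2 * h (?c m (sharp (sharp y))) + 1 * t * h (?c m (polar sharp (sharp x) (polar sharp x
          y)))
      + 1 * t\<^sup>2 * h (?c m (polar sharp (sharp x) (sharp y)))
      + t * t\<^sup>2 * h (?c m (polar sharp (polar sharp x y) (sharp y)))"
      by (rule sh[OF m])
    ultimately have "h (?c m (sharp (sharp x))) + t * h (?c m (polar sharp (sharp x) (polar sharp x
        y)))
       + t\<^sup>2 * h (?c m (polar sharp (sharp x) (sharp y) + sharp (polar sharp x y)))
       + t ^ 3 * h (?c m (polar sharp (polar sharp x y) (sharp y)))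
           + t ^ 4 * h (?c m (sharp (sharp y)))
      = (h (N x) + t * h (dN x y) + t\<^sup>2 * h (dN y x) + t ^ 3 * h (N y)) * X m"
      by (simp add: c_simps h numeral_eq_Suc algebra_simps)
    also have "\<dots> = h (N x * ?c m x) + t * h (N x * ?c m y + dN x y * ?c m x)
       + t\<^sup>2 * h (dN x y * ?c m y + dN y x * ?c m x) + t ^ 3 * h (dN y x * ?c m y + N y * ?c m x)
       + t ^ 4 * h (N y * ?c m y)"
      using m by (simp add: X_def h numeral_eq_Suc algebra_simps)
    finally show ?thesis
      unfolding h_def t_def Fract_poly4 by (simp add: eq_fract)
  qed
  show ?A1 ?A2 ?A3
    by (rule coord_eqI[OF e], use A in \<open>simp add: c_simps\<close>)+

  define E where "E x = (\<lambda>i\<in>{..<n}. h (?c i x))" for x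
  have sh_E: "?sh (E x) m = h (?c m (sharp x))" if "m < n" for x m
    by (subst sh[OF that, where a = 1 and b = 0 and c = 0 and x = x and y = x and z = x])
      (auto simp: E_def)
  have E_coord: "E x m = h (?c m x)" if "m < n" for x m
    using that by (simp add: E_def)
  have bilin: "ext_bilin field_ring h n e (trace_form dN unt) X (E y) = h (trace_form dN unt x y)"
    if "\<And>i. i < n \<Longrightarrow> X i = h (?c i x)" for X x y
  proof -
    let ?T = "trace_form dN unt"
    have "?T x y = ?T (\<Sum>i<n. s (?c i x) (e i)) y"
      by (simp add: coord_combination[OF e])
    also have "\<dots> = (\<Sum>i<n. ?c i x * ?T y (e i))"
      by (simp add: trace_form_sum_left[OF N] trace_form_commute[OF N, of unt y])
    also have "\<dots> = (\<Sum>i<n. ?c i x * ?T (\<Sum>j<n. s (?c j y) (e j)) (e i))"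
      by (simp add: coord_combination[OF e])
    also have "\<dots> = (\<Sum>i<n. \<Sum>j<n. ?c i x * ?c j y * ?T (e j) (e i))"
      by (simp add: trace_form_sum_left[OF N] sum_distrib_left algebra_simps)
    also have "\<dots> = (\<Sum>i<n. \<Sum>j<n. ?T (e i) (e j) * (?c i x * ?c j y))"
      by (subst trace_form_commute[OF N]) (simp only: mult.commute)
    finally show ?thesis
      using that by (simp add: ext_bilin_def E_def h_sum[OF h] h)
  qed
  have deriv: "ext_deriv field_ring h n e dN (E x) (E y) = h (dN x y)" for x y
  proof -
    have "ext_quad field_ring h n e (\<lambda>w. dN w (e j)) (E x) = h (dN x (e j))" for j
      using ext_quad_combination[OF h cubic_form_quadratic[OF N], of n "E x" 1 "\<lambda>i. ?c i x" 0 "\<lambda>i.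
          ?c i x"
          0 "\<lambda>i. ?c i x" x e x x, OF _ comb comb comb]
      by (simp add: E_def)
    moreover have "dN x y = dN x (\<Sum>i<n. s (?c i y) (e i))"
      by (simp add: coord_combination[OF e])
    then have "dN x y = (\<Sum>i<n. ?c i y * dN x (e i))"
      by (simp add: cubic_form_sum_right[OF N])
    ultimately show ?thesis
      by (simp add: ext_deriv_def E_def h_sum[OF h] h mult.commute)
  qed
  have E_mem: "E x \<in> {..<n} \<rightarrow>\<^sub>E UNIV" for x
    by (simp add: E_def)
  then have "ext_deriv field_ring h n e dN (E x) (E y) = ext_bilin field_ring h n e (trace_form dN
      unt) (?sh (E x)) (E y)"
    using ids by (auto simp: cubic_identities_def Let_def)
  then show ?D
    by (simp add: deriv bilin[OF sh_E] h_inj)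
  have unit: "\<forall>Y\<in>{..<n} \<rightarrow>\<^sub>E UNIV. \<forall>m<n. ?sh (\<lambda>i\<in>{..<n}. E unt i + Y i) m - ?sh (E unt) m - ?sh Y m =
      ext_bilin field_ring h n e (trace_form dN unt) Y (E unt) * E unt m - Y m"
    using ids by (simp add: cubic_identities_def Let_def flip: E_def)
  have "h (?c m (sharp (unt + y))) - h (?c m (sharp unt)) - h (?c m (sharp y)) = 
    h (trace_form dN unt y unt) * h (?c m unt) - h (?c m y)" if m: "m < n" for m
  proof -
    have "?sh (\<lambda>i\<in>{..<n}. E unt i + E y i) m - ?sh (E unt) m - ?sh (E y) m = 
       ext_bilin field_ring h n e (trace_form dN unt) (E y) (E unt) * E unt m - E y m"
      using unit m E_mem by blast
    moreover have "(\<lambda>i\<in>{..<n}. E unt i + E y i) = E (unt + y)"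
      by (auto simp: E_def c_simps h)
    ultimately show ?thesis using m
      by (simp add: sh_E bilin[OF E_coord] E_coord)
  qed
  then show ?U
    by (intro coord_eqI[OF e]) (simp add: polar_def c_simps h_diff[symmetric] h(2)[symmetric] h_inj)
qed

text \<open>
  Nondegeneracy of \<open>T\<close> allows vectors to be compared through their traces; the invertibility
  of 3 gives access to \<open>N\<close> through \<open>T(a\<^sup>#, a) = 3 N(a)\<close>.
\<close>

locale nondegenerate_cubic_jordan = vector_space scale
  for scale :: "'k::field \<Rightarrow> 'j::ab_group_add \<Rightarrow> 'j" +
  fixes N :: "'j \<Rightarrow> 'k" and dN :: "'j \<Rightarrow> 'j \<Rightarrow> 'k" and sharp :: "'j \<Rightarrow> 'j" and unt :: 'j
  assumes jordan: "cubic_jordan_algebra scale N dN sharp unt"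
    and nondegenerate: "(\<And>y. trace_form dN unt x y = 0) \<Longrightarrow> x = 0"
    and three: "(3::'k) \<noteq> 0"
begin

abbreviation T :: "'j \<Rightarrow> 'j \<Rightarrow> 'k" where "T \<equiv> trace_form dN unt"
abbreviation tr :: "'j \<Rightarrow> 'k" where "tr x \<equiv> T x unt"
abbreviation S :: "'j \<Rightarrow> 'k" where "S x \<equiv> tr (sharp x)"
abbreviation cross :: "'j \<Rightarrow> 'j \<Rightarrow> 'j" (infixl "\<diamondop>" 72) where "x \<diamondop> y \<equiv> polar sharp x y"

lemma cubic: "cubic_form scale N dN" and quadratic: "quadratic_map scale scale sharp"
  and N_unt [simp]: "N unt = 1"
  using jordan by (simp_all add: cubic_jordan_algebra_def)

lemma T_commute: "T x y = T y x"
  by (rule trace_form_commute[OF cubic])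

lemma T_simps [simp]:
  "T (x + y) z = T x z + T y z" "T (scale c x) z = c * T x z" "T 0 z = 0" "T (- x) z = - T x z"
  "T (x - y) z = T x z - T y z"
proof -
  show add: "T (x + y) z = T x z + T y z" and scale: "T (scale c x) z = c * T x z" for x y z c
    by (rule trace_form_add_left[OF cubic] trace_form_scale_left[OF cubic])+
  show "T 0 z = 0" using scale[of 0 0 z] by simp
  show minus: "T (- x) z = - T x z" for x z using scale[of "-1" x z] by simp
  show "T (x - y) z = T x z - T y z" using add[of x "- y"] minus by simp
qed

lemma T_simps_right [simp]:
  "T z (x + y) = T z x + T z y" "T z (scale c x) = c * T z x" "T z 0 = 0" "T z (- x) = - T z x"
  "T z (x - y) = T z x - T z y"
  by (simp_all add: T_commute[of z])

lemma T_eqI: "(\<And>z. T x z = T y z) \<Longrightarrow> x = y"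
  using nondegenerate[of "x - y"] by simp

lemma cross_commute: "x \<diamondop> y = y \<diamondop> x"
  by (rule polar_commute)

lemma cross_simps [simp]:
  "(x + y) \<diamondop> z = x \<diamondop> z + y \<diamondop> z" "scale c x \<diamondop> z = scale c (x \<diamondop> z)" "0 \<diamondop> z = 0" "- x \<diamondop> z = - (x \<diamondop> z)"
  "(x - y) \<diamondop> z = x \<diamondop> z - y \<diamondop> z"
proof -
  show add: "(x + y) \<diamondop> z = x \<diamondop> z + y \<diamondop> z" and scale: "scale c x \<diamondop> z = scale c (x \<diamondop> z)" for x y z c
    by (rule polar_add_left[OF quadratic] polar_scale_left[OF quadratic])+
  show "0 \<diamondop> z = 0" using scale[of 0 0 z] by simp
  show minus: "- x \<diamondop> z = - (x \<diamondop> z)" for x z using scale[of "-1" x z] by simp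
  show "(x - y) \<diamondop> z = x \<diamondop> z - y \<diamondop> z" using add[of x "- y"] minus by simp
qed

lemma cross_simps_right [simp]:
  "z \<diamondop> (x + y) = z \<diamondop> x + z \<diamondop> y" "z \<diamondop> (scale c x) = scale c (z \<diamondop> x)" "z \<diamondop> 0 = 0" "z \<diamondop> (- x) =
      - (z \<diamondop> x)"
  "z \<diamondop> (x - y) = z \<diamondop> x - z \<diamondop> y"
  by (simp_all add: cross_commute[of z])

lemma sharp_add: "sharp (x + y) = sharp x + sharp y + x \<diamondop> y"
  by (rule quadratic_map_add)

lemma sharp_scale: "sharp (scale c x) = scale (c\<^sup>2) (sharp x)"
  by (rule quadratic_map_scale[OF quadratic])

lemma cross_self: "x \<diamondop> x = scale 2 (sharp x)"
  using sharp_scale[of 2 x] scale_left_distrib[of 1 1 x] scale_left_distrib[of 2 2 "sharp x"]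
    scale_left_distrib[of 1 1 "sharp x"]
  by (simp add: polar_def power2_eq_square)

lemma sharp_sharp: "sharp (sharp x) = scale (N x) x"
  by (rule cubic_jordan_algebra_identities(1)[OF jordan])

lemma dN_eq: "dN x y = T (sharp x) y"
  by (rule cubic_jordan_algebra_identities(4)[OF jordan])

lemma sharp_cross_cross: "sharp x \<diamondop> (x \<diamondop> y) = scale (N x) y + scale (T (sharp x) y) x"
  using cubic_jordan_algebra_identities(2)[OF jordan] by (simp add: dN_eq)

lemma sharp_cross:
  "sharp (x \<diamondop> y) = scale (T (sharp x) y) y + scale (T (sharp y) x) x - sharp x \<diamondop> sharp y"
  using cubic_jordan_algebra_identities(3)[OF jordan, of x y] by (simp add: dN_eq algebra_simps)

lemma unt_cross [simp]: "unt \<diamondop> y = scale (tr y) unt - y" "y \<diamondop> unt = scale (tr y) unt - y"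
  using cubic_jordan_algebra_identities(5)[OF jordan, of y] by (simp_all add: cross_commute[of y])

lemma T_sharp_self: "T (sharp x) x = 3 * N x" "T x (sharp x) = 3 * N x"
  using cubic_form_self[OF cubic, of x] by (simp_all add: dN_eq T_commute)

text \<open>
  Both sides are the trilinear form of \<open>N\<close>, which is symmetric.
\<close>

lemma T_cross: "T (x \<diamondop> y) z = T x (y \<diamondop> z)"
proof -
  have d2N: "d2N dN u v w = T (u \<diamondop> v) w" for u v w
    by (simp add: d2N_def polar_def dN_eq)
  show ?thesis
    using d2N_rotate[OF cubic, of x y z] by (simp add: d2N T_commute[of _ x])
qed

text \<open>
  The identity \<open>1 \<diamondop> 1 = tr(1) 1 - 1\<close> only yields twice this equation, which says nothing in
  characteristic 2. Instead \<open>T(1\<^sup>#, z)\<close> is the derivative of \<open>N\<close> at the unit, which is the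
  trace of \<open>z\<close>.
\<close>

lemma sharp_unt [simp]: "sharp unt = unt"
proof (rule T_eqI)
  have "tr y = dN unt y" for y
  proof -
    have "d2N dN unt y unt = 2 * dN unt y"
      by (metis d2N_swap[OF cubic] d2N_self[OF cubic])
    then show ?thesis
      using cubic_form_self[OF cubic, of unt] by (simp add: trace_form_def algebra_simps)
  qed
  then show "T (sharp unt) z = T unt z" for z
    by (metis dN_eq T_commute)
qed

lemma tr_unt [simp]: "tr unt = 3"
  using T_sharp_self[of unt] by simp

lemma tr_cross: "tr (x \<diamondop> y) = tr x * tr y - T x y"
  by (simp add: T_cross)

text \<open>
  The operator \<open>z \<mapsto> x \<diamondop> (x\<^sup># \<diamondop> z)\<close> is the adjoint with respect to \<open>T\<close> of
  \<open>z \<mapsto> x\<^sup># \<diamondop> (x \<diamondop> z)\<close>, which is known from the linearised adjoint identity.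
\<close>

lemma cross_sharp_cross: "x \<diamondop> (sharp x \<diamondop> y) = scale (N x) y + scale (T x y) (sharp x)"
proof (rule T_eqI)
  fix z
  have "T (x \<diamondop> (sharp x \<diamondop> y)) z = T ((y \<diamondop> sharp x) \<diamondop> x) z"
    by (metis cross_commute)
  also have "\<dots> = T y (sharp x \<diamondop> (x \<diamondop> z))"
    by (simp only: T_cross)
  finally have "T (x \<diamondop> (sharp x \<diamondop> y)) z = T y (sharp x \<diamondop> (x \<diamondop> z))" .
  then show "T (x \<diamondop> (sharp x \<diamondop> y)) z = T (scale (N x) y + scale (T x y) (sharp x)) z"
    by (simp add: sharp_cross_cross T_commute[of y] mult.commute)
qed

lemma cross_sharp: "x \<diamondop> sharp x = scale (tr x * S x - N x) unt - scale (S x) x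
    - scale (tr x) (sharp x)"
proof -
  have "scale (S x) (scale (tr x) unt - x) - x \<diamondop> sharp x = scale (N x) unt + scale (tr x) (sharp x)"
    using cross_sharp_cross[of x unt] by simp
  then have "x \<diamondop> sharp x = scale (S x) (scale (tr x) unt - x) - (scale (N x) unt
      + scale (tr x) (sharp x))"
    by (simp add: diff_eq_eq)
  then show ?thesis
    by (simp add: scale_right_diff_distrib scale_left_diff_distrib mult.commute)
qed

lemma cross_cross_same:
  "(x \<diamondop> y) \<diamondop> (x \<diamondop> z) = scale (T (sharp x) y) z + scale (T (sharp x) z) y + scale (T (y \<diamondop> z) x) x
    - sharp x \<diamondop> (y \<diamondop> z)"
  using sharp_cross[of x "y + z"] sharp_cross[of x y] sharp_cross[of x z]
  by (simp add: sharp_add algebra_simps)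

text \<open>
  The full linearisation. It determines only the sum of two products; in the table below it
  gives \<open>(x \<diamondop> y\<^sup>#) \<diamondop> (x\<^sup># \<diamondop> y)\<close> once \<open>(x \<diamondop> y) \<diamondop> (x\<^sup># \<diamondop> y\<^sup>#)\<close> has been found by other means.
\<close>

lemma cross_cross_sym:
  "(x \<diamondop> y) \<diamondop> (w \<diamondop> z) + (x \<diamondop> z) \<diamondop> (w \<diamondop> y) =
    scale (T (x \<diamondop> w) y) z + scale (T (x \<diamondop> w) z) y + scale (T (y \<diamondop> z) x) w + scale (T (y \<diamondop> z) w) x
    - (x \<diamondop> w) \<diamondop> (y \<diamondop> z)"
  using cross_cross_same[of "x + w" y z] cross_cross_same[of x y z] cross_cross_same[of w y z]
    cross_commute[of "x \<diamondop> z" "w \<diamondop> y"] cross_commute[of w x]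
  by (simp add: sharp_add algebra_simps)

text \<open>
  The special case \<open>z = 1\<close> of \<open>cross_cross_same\<close>, solved for \<open>x \<diamondop> (x \<diamondop> y)\<close>.
\<close>

lemma cross_cross_self:
  "x \<diamondop> (x \<diamondop> y) = scale (tr x) (scale (tr (x \<diamondop> y)) unt - x \<diamondop> y) + scale (tr y) (scale (S x) unt
      - sharp x)
    - sharp x \<diamondop> y - scale (T (sharp x) y) unt - scale (S x) y - scale (tr x * tr y - T x y) x"
proof -
  have "x \<diamondop> (x \<diamondop> y) = (x \<diamondop> y) \<diamondop> x" by (rule cross_commute)
  then show ?thesis
  using cross_cross_same[of x y unt] T_commute[of x y] T_commute[of unt x] by (simp add:
      algebra_simps)
qed

lemma N_scale: "N (scale c x) = c ^ 3 * N x"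
  by (rule cubic_form_scale[OF cubic])

text \<open>
  The threefold sharp of \<open>x\<close> is \<open>N(x\<^sup>#) x\<^sup>#\<close>, and also \<open>(N(x) x)\<^sup># = N(x)\<^sup>2 x\<^sup>#\<close>.
\<close>

lemma N_sharp: "N (sharp x) = (N x)\<^sup>2"
proof (cases "sharp x = 0")
  case True
  then show ?thesis
    using sharp_sharp[of x] sharp_scale[of 0 0] N_scale[of 0 0] by (auto simp: zero_power)
next
  case False
  have "scale (N (sharp x)) (sharp x) = scale ((N x)\<^sup>2) (sharp x)"
    using sharp_sharp[of "sharp x"] unfolding sharp_sharp[of x] sharp_scale by (rule sym)
  then show ?thesis using False by (metis scale_right_imp_eq)
qed

text \<open>
  Compute \<open>T(a\<^sup>#, a) = 3 N(a)\<close> for \<open>a = x \<diamondop> y\<close> with the formula for \<open>(x \<diamondop> y)\<^sup>#\<close>.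
\<close>

lemma N_cross: "N (x \<diamondop> y) = T (sharp x) y * T (sharp y) x - N x * N y"
proof -
  have "T (sharp x \<diamondop> sharp y) (x \<diamondop> y) = T (sharp y) (sharp x \<diamondop> (x \<diamondop> y))"
    by (metis T_cross cross_commute)
  also have "\<dots> = 3 * N x * N y + T (sharp x) y * T (sharp y) x"
    by (simp add: sharp_cross_cross T_sharp_self)
  finally have mixed: "T (sharp x \<diamondop> sharp y) (x \<diamondop> y) = 3 * N x * N y
      + T (sharp x) y * T (sharp y) x" .
  have "T y (x \<diamondop> y) = 2 * T (sharp y) x" "T x (x \<diamondop> y) = 2 * T (sharp x) y"
    by (metis T_cross T_commute cross_commute cross_self T_simps(2))+
  then have "3 * N (x \<diamondop> y) = 3 * (T (sharp x) y * T (sharp y) x - N x * N y)"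
    unfolding T_sharp_self(1)[symmetric] sharp_cross by (simp add: mixed algebra_simps)
  then show ?thesis by (rule mult_left_cancel[OF three, THEN iffD1])
qed

text \<open>
  By the formula for \<open>(x \<diamondop> y)\<^sup>#\<close>, the element \<open>x\<^sup># \<diamondop> y\<^sup>#\<close> equals \<open>- (x \<diamondop> y)\<^sup>#\<close> up to
  multiples of \<open>x\<close> and \<open>y\<close>. This reduces the product to \<open>a \<diamondop> a\<^sup>#\<close> with \<open>a = x \<diamondop> y\<close>.
\<close>

lemma cross_cross_sharp:
  "(x \<diamondop> y) \<diamondop> (sharp x \<diamondop> sharp y) =
    scale (T (sharp x) y) (y \<diamondop> (x \<diamondop> y)) + scale (T (sharp y) x) (x \<diamondop> (x \<diamondop> y))
    - (x \<diamondop> y) \<diamondop> sharp (x \<diamondop> y)"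
  by (simp add: sharp_cross cross_commute[of "x \<diamondop> y"])

end

section \<open>The multiplication table of two elements of trace zero\<close>

text \<open>
  The notation for the eight invariants is that of the discriminant, with \<open>x\<close> and \<open>y\<close> in the
  roles of \<open>\<sigma>\<close> and \<open>\<upsilon>\<close>.
\<close>

locale traceless_pair = nondegenerate_cubic_jordan +
  fixes x y :: 'b
  assumes tr_x [simp]: "tr x = 0" and tr_y [simp]: "tr y = 0"
begin

abbreviation "N1 \<equiv> N x"
abbreviation "N2 \<equiv> N y"
abbreviation "S1 \<equiv> S x"
abbreviation "S2 \<equiv> S y"
abbreviation "T11 \<equiv> T x y"
abbreviation "T12 \<equiv> T x (sharp y)"
abbreviation "T21 \<equiv> T (sharp x) y"
abbreviation "T22 \<equiv> T (sharp x) (sharp y)"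

definition lin :: "'a \<Rightarrow> 'a \<Rightarrow> 'a \<Rightarrow> 'a \<Rightarrow> 'a \<Rightarrow> 'a \<Rightarrow> 'a \<Rightarrow> 'a \<Rightarrow> 'a \<Rightarrow> 'b" where
  "lin c0 c1 c2 c3 c4 c5 c6 c7 c8 = scale c0 unt + scale c1 x + scale c2 (sharp x) + scale c3 y
    + scale c4 (sharp y) + scale c5 (x \<diamondop> y) + scale c6 (x \<diamondop> sharp y)
    + scale c7 (sharp x \<diamondop> y) + scale c8 (sharp x \<diamondop> sharp y)"

lemma lin_add: "lin a0 a1 a2 a3 a4 a5 a6 a7 a8 + lin b0 b1 b2 b3 b4 b5 b6 b7 b8
    = lin (a0 + b0) (a1 + b1) (a2 + b2) (a3 + b3) (a4 + b4) (a5 + b5) (a6 + b6) (a7 + b7) (a8 + b8)"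
  by (simp add: lin_def algebra_simps)

lemma lin_scale: "scale a (lin c0 c1 c2 c3 c4 c5 c6 c7 c8)
    = lin (a * c0) (a * c1) (a * c2) (a * c3) (a * c4) (a * c5) (a * c6) (a * c7) (a * c8)"
  by (simp add: lin_def algebra_simps)

text \<open>
  Products and traces are written with the factor that comes from \<open>x\<close> in front. The trace of
  the unit with itself is left out, since rewriting \<open>T unt z\<close> to \<open>T z unt\<close> would not
  terminate at \<open>z = unt\<close>.
\<close>

lemma normal_order: "y \<diamondop> x = x \<diamondop> y" "y \<diamondop> sharp x = sharp x \<diamondop> y" "sharp y \<diamondop> x = x \<diamondop> sharp y"
  "sharp y \<diamondop> sharp x = sharp x \<diamondop> sharp y"
  "T y x = T x y" "T y (sharp x) = T (sharp x) y" "T (sharp y) x = T x (sharp y)"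
  "T (sharp y) (sharp x) = T (sharp x) (sharp y)" "T unt x = 0" "T unt y = 0" "T unt (sharp z) = S
      z" "T unt (z \<diamondop> w) = tr (z \<diamondop> w)"
  using T_commute[of unt x] T_commute[of unt y] by (simp_all only: tr_x tr_y) (rule cross_commute
      T_commute)+

lemmas normal_form = normal_order lin_def tr_cross sharp_sharp cross_sharp N_sharp power2_eq_square
    algebra_simps

text \<open>
  In the names of the following facts the digits 0 to 8 number the arguments of \<open>lin\<close>:
  \<open>cross_ij\<close> is the product of the elements \<open>i\<close> and \<open>j\<close>, and \<open>sharp_ii\<close> is the sharp of the
  element \<open>i\<close>.
\<close>

lemma cross_12: "x \<diamondop> sharp x = lin (-N1) (-S1) 0 0 0 0 0 0 0"
  using cross_sharp[of x] by (simp add: normal_form)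

lemma cross_15: "x \<diamondop> (x \<diamondop> y) = lin (-T21) T11 0 (-S1) 0 0 0 (-1) 0"
  using cross_cross_self[of x y] by (simp add: normal_form)

lemma cross_16: "x \<diamondop> (x \<diamondop> sharp y) = lin (S1*S2 - T22) T12 (-S2) 0 (-S1) 0 0 0 (-1)"
  using cross_cross_self[of x "sharp y"] by (simp add: normal_form)

lemma cross_17: "x \<diamondop> (sharp x \<diamondop> y) = lin 0 0 T11 N1 0 0 0 0 0"
  using cross_sharp_cross[of x y] by (simp add: normal_form)

lemma cross_18: "x \<diamondop> (sharp x \<diamondop> sharp y) = lin 0 0 T12 0 N1 0 0 0 0"
  using cross_sharp_cross[of x "sharp y"] by (simp add: normal_form)

lemma cross_25: "sharp x \<diamondop> (x \<diamondop> y) = lin 0 T21 0 N1 0 0 0 0 0"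
  using sharp_cross_cross[of x y] by (simp add: normal_form)

lemma cross_26: "sharp x \<diamondop> (x \<diamondop> sharp y) = lin 0 T22 0 0 N1 0 0 0 0"
  using sharp_cross_cross[of x "sharp y"] by (simp add: normal_form)

lemma cross_27: "sharp x \<diamondop> (sharp x \<diamondop> y) = lin (-N1*T11 - S1*T21) 0 T21 0 0 (-N1) 0 (-S1) 0"
  using cross_cross_self[of "sharp x" y] by (simp add: normal_form)

lemma cross_28: "sharp x \<diamondop> (sharp x \<diamondop> sharp y) = lin (-N1*T12 + S1^2*S2 - S1*T22) (-N1*S2) (-S1*S2
    + T22) 0 0 0 (-N1) 0 (-S1)"
  using cross_cross_self[of "sharp x" "sharp y"] by (simp add: normal_form)

lemma cross_34: "y \<diamondop> sharp y = lin (-N2) 0 0 (-S2) 0 0 0 0 0"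
  using cross_sharp[of y] by (simp add: normal_form)

lemma cross_35: "y \<diamondop> (x \<diamondop> y) = lin (-T12) (-S2) 0 T11 0 0 (-1) 0 0"
  using cross_cross_self[of y x] by (simp add: normal_form)

lemma cross_37: "y \<diamondop> (sharp x \<diamondop> y) = lin (S1*S2 - T22) 0 (-S2) T21 (-S1) 0 0 0 (-1)"
  using cross_cross_self[of y "sharp x"] by (simp add: normal_form)

lemma cross_36: "y \<diamondop> (x \<diamondop> sharp y) = lin 0 N2 0 0 T11 0 0 0 0"
  using cross_sharp_cross[of y x] by (simp add: normal_form)

lemma cross_38: "y \<diamondop> (sharp x \<diamondop> sharp y) = lin 0 0 N2 0 T21 0 0 0 0"
  using cross_sharp_cross[of y "sharp x"] by (simp add: normal_form)

lemma cross_45: "sharp y \<diamondop> (x \<diamondop> y) = lin 0 N2 0 T12 0 0 0 0 0"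
  using sharp_cross_cross[of y x] by (simp add: normal_form)

lemma cross_47: "sharp y \<diamondop> (sharp x \<diamondop> y) = lin 0 0 N2 T22 0 0 0 0 0"
  using sharp_cross_cross[of y "sharp x"] by (simp add: normal_form)

lemma cross_46: "sharp y \<diamondop> (x \<diamondop> sharp y) = lin (-N2*T11 - S2*T12) 0 0 0 T12 (-N2) (-S2) 0 0"
  using cross_cross_self[of "sharp y" x] by (simp add: normal_form)

lemma cross_48: "sharp y \<diamondop> (sharp x \<diamondop> sharp y) = lin (-N2*T21 + S1*S2^2
    - S2*T22) 0 0 (-N2*S1) (-S1*S2 + T22) 0 0 (-N2) (-S2)"
  using cross_cross_self[of "sharp y" "sharp x"] by (simp add: normal_form)

lemma sharp_55: "sharp (x \<diamondop> y) = lin 0 T12 0 T21 0 0 0 0 (-1)"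
  using sharp_cross[of x y] by (simp add: normal_form)

lemma sharp_66: "sharp (x \<diamondop> sharp y) = lin 0 (N2*T11) 0 0 T22 0 0 (-N2) 0"
  using sharp_cross[of x "sharp y"] by (simp add: normal_form)

lemma sharp_77: "sharp (sharp x \<diamondop> y) = lin 0 0 T22 (N1*T11) 0 0 (-N1) 0 0"
  using sharp_cross[of "sharp x" y] by (simp add: normal_form)

lemma sharp_88: "sharp (sharp x \<diamondop> sharp y) = lin 0 0 (N2*T21) 0 (N1*T12) (-N1*N2) 0 0 0"
  using sharp_cross[of "sharp x" "sharp y"] by (simp add: normal_form)

lemma cross_56: "(x \<diamondop> y) \<diamondop> (x \<diamondop> sharp y) = lin (N2*S1) (-S2*T11) (-N2) T22 T21 0 0 S2 0"
  using cross_cross_same[of x y "sharp y"] by (simp add: normal_form)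

lemma cross_78: "(sharp x \<diamondop> y) \<diamondop> (sharp x \<diamondop> sharp y) = lin 0 (-N1*N2) (-N2*S1
    - S2*T21) (N1*T12) (N1*T11) (N1*S2) 0 0 0"
  using cross_cross_same[of "sharp x" y "sharp y"] by (simp add: normal_form)

lemma cross_57: "(x \<diamondop> y) \<diamondop> (sharp x \<diamondop> y) = lin (N1*S2) T22 T12 (-S1*T11) (-N1) 0 S1 0 0"
  using cross_cross_same[of y x "sharp x"] by (simp add: normal_form)

lemma cross_68: "(x \<diamondop> sharp y) \<diamondop> (sharp x \<diamondop> sharp y) = lin 0 (N2*T21) (N2*T11) (-N1*N2) (-N1*S2
    - S1*T12) (N2*S1) 0 0 0"
  using cross_cross_same[of "sharp y" x "sharp x"] by (simp add: normal_form)

lemma cross_58: "(x \<diamondop> y) \<diamondop> (sharp x \<diamondop> sharp y) = lin (-N1*N2 - S1*S2*T11 + T11*T22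
    - T12*T21) (-S2*T21) 0 (-S1*T12) 0 (-S1*S2 + T22) (-T21) (-T12) T11"
  unfolding cross_cross_sharp cross_sharp[of "x \<diamondop> y"]
  unfolding cross_15 cross_35 N_cross sharp_55 by (simp add: normal_form)

lemma scale_triple: "scale (a * (b * 3)) z = scale (a * b) z + scale (a * b) z + scale (a * b) z"
proof -
  have "a * (b * 3) = a * b + a * b + a * b" by simp
  then show ?thesis by (simp only: scale_left_distrib)
qed

lemma cross_67: "(x \<diamondop> sharp y) \<diamondop> (sharp x \<diamondop> y) = lin (-N1*N2 + S1*S2*T11 - T11*T22
    + T12*T21) 0 (-S2*T11) 0 (-S1*T11) (-T22) T21 T12 (-T11)"
proof -
  have "(x \<diamondop> sharp y) \<diamondop> (sharp x \<diamondop> y) = scale (T (x \<diamondop> sharp x) y) (sharp y)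
      + scale (T (x \<diamondop> sharp x) (sharp y)) y
      + scale (T (y \<diamondop> sharp y) x) (sharp x) + scale (T (y \<diamondop> sharp y) (sharp x)) x
      - (x \<diamondop> sharp x) \<diamondop> (y \<diamondop> sharp y) - (x \<diamondop> y) \<diamondop> (sharp x \<diamondop> sharp y)"
    using cross_cross_sym[of x y "sharp x" "sharp y"] by (simp only: eq_diff_eq add.commute)
  then show ?thesis
    by (simp only: cross_58 cross_sharp) (simp add: normal_form scale_triple)
qed

lemma
  shows sharp_00: "sharp unt = lin 1 0 0 0 0 0 0 0 0"
    and sharp_11: "sharp x = lin 0 0 1 0 0 0 0 0 0"
    and sharp_22: "sharp (sharp x) = lin 0 N1 0 0 0 0 0 0 0"
    and sharp_33: "sharp y = lin 0 0 0 0 1 0 0 0 0"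
    and sharp_44: "sharp (sharp y) = lin 0 0 0 N2 0 0 0 0 0"
    and cross_23: "sharp x \<diamondop> y = lin 0 0 0 0 0 0 0 1 0"
    and cross_24: "sharp x \<diamondop> sharp y = lin 0 0 0 0 0 0 0 0 1"
    and cross_13: "x \<diamondop> y = lin 0 0 0 0 0 1 0 0 0"
    and cross_14: "x \<diamondop> sharp y = lin 0 0 0 0 0 0 1 0 0"
    and cross_01: "unt \<diamondop> x = lin 0 (-1) 0 0 0 0 0 0 0"
    and cross_02: "unt \<diamondop> sharp x = lin S1 0 (-1) 0 0 0 0 0 0"
    and cross_03: "unt \<diamondop> y = lin 0 0 0 (-1) 0 0 0 0 0"
    and cross_04: "unt \<diamondop> sharp y = lin S2 0 0 0 (-1) 0 0 0 0"
    and cross_05: "unt \<diamondop> (x \<diamondop> y) = lin (-T11) 0 0 0 0 (-1) 0 0 0"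
    and cross_06: "unt \<diamondop> (x \<diamondop> sharp y) = lin (-T12) 0 0 0 0 0 (-1) 0 0"
    and cross_07: "unt \<diamondop> (sharp x \<diamondop> y) = lin (-T21) 0 0 0 0 0 0 (-1) 0"
    and cross_08: "unt \<diamondop> (sharp x \<diamondop> sharp y) = lin (S1*S2 - T22) 0 0 0 0 0 0 0 (-1)"
  by (simp_all add: normal_form)

text \<open>
  This keeps the substitution of the table into the expansion apart from rewriting: the
  entries of the table are nested in each other, so using them as rewrite rules would
  destroy their left-hand sides.
\<close>

lemma sharp_combination:
  assumes "sharp e0 = l00" and "sharp e1 = l11" and "sharp e2 = l22" and "sharp e3 = l33"
      and "sharp e4 = l44" and "sharp e5 = l55" and "sharp e6 = l66" and "sharp e7 = l77"
      and "sharp e8 = l88" and "e7 \<diamondop> e8 = l78" and "e6 \<diamondop> e7 = l67" and "e6 \<diamondop> e8 = l68"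
      and "e5 \<diamondop> e6 = l56" and "e5 \<diamondop> e7 = l57" and "e5 \<diamondop> e8 = l58" and "e4 \<diamondop> e5 = l45"
      and "e4 \<diamondop> e6 = l46" and "e4 \<diamondop> e7 = l47" and "e4 \<diamondop> e8 = l48" and "e3 \<diamondop> e4 = l34"
      and "e3 \<diamondop> e5 = l35" and "e3 \<diamondop> e6 = l36" and "e3 \<diamondop> e7 = l37" and "e3 \<diamondop> e8 = l38"
      and "e2 \<diamondop> e3 = l23" and "e2 \<diamondop> e4 = l24" and "e2 \<diamondop> e5 = l25" and "e2 \<diamondop> e6 = l26"
      and "e2 \<diamondop> e7 = l27" and "e2 \<diamondop> e8 = l28" and "e1 \<diamondop> e2 = l12" and "e1 \<diamondop> e3 = l13"
      and "e1 \<diamondop> e4 = l14" and "e1 \<diamondop> e5 = l15" and "e1 \<diamondop> e6 = l16" and "e1 \<diamondop> e7 = l17"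
      and "e1 \<diamondop> e8 = l18" and "e0 \<diamondop> e1 = l01" and "e0 \<diamondop> e2 = l02" and "e0 \<diamondop> e3 = l03"
      and "e0 \<diamondop> e4 = l04" and "e0 \<diamondop> e5 = l05" and "e0 \<diamondop> e6 = l06" and "e0 \<diamondop> e7 = l07"
      and "e0 \<diamondop> e8 = l08"
  shows "sharp (scale c0 e0 + scale c1 e1 + scale c2 e2 + scale c3 e3 + scale c4 e4 + scale c5 e5
      + scale c6 e6 + scale c7 e7 + scale c8 e8) =
    scale (c0\<^sup>2) l00 + scale (c1\<^sup>2) l11 + scale (c2\<^sup>2) l22 + scale (c3\<^sup>2) l33 + scale (c4\<^sup>2) l44
        + scale (c5\<^sup>2) l55 + scale (c6\<^sup>2) l66 + scale (c7\<^sup>2) l77 + scale (c8\<^sup>2) l88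
        + scale (c7 * c8) l78 + scale (c6 * c7) l67 + scale (c6 * c8) l68 + scale (c5 * c6) l56
        + scale (c5 * c7) l57 + scale (c5 * c8) l58 + scale (c4 * c5) l45 + scale (c4 * c6) l46
        + scale (c4 * c7) l47 + scale (c4 * c8) l48 + scale (c3 * c4) l34 + scale (c3 * c5) l35
        + scale (c3 * c6) l36 + scale (c3 * c7) l37 + scale (c3 * c8) l38 + scale (c2 * c3) l23
        + scale (c2 * c4) l24 + scale (c2 * c5) l25 + scale (c2 * c6) l26 + scale (c2 * c7) l27
        + scale (c2 * c8) l28 + scale (c1 * c2) l12 + scale (c1 * c3) l13 + scale (c1 * c4) l14
        + scale (c1 * c5) l15 + scale (c1 * c6) l16 + scale (c1 * c7) l17 + scale (c1 * c8) l18
        + scale (c0 * c1) l01 + scale (c0 * c2) l02 + scale (c0 * c3) l03 + scale (c0 * c4) l04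
        + scale (c0 * c5) l05 + scale (c0 * c6) l06 + scale (c0 * c7) l07 + scale (c0 * c8) l08"
  by (simp only: sharp_add sharp_scale cross_simps cross_simps_right scale_scale assms mult.commute
      add.assoc)

lemma lin_cong: "a0 = b0 \<Longrightarrow> a1 = b1 \<Longrightarrow> a2 = b2 \<Longrightarrow> a3 = b3 \<Longrightarrow> a4 = b4 \<Longrightarrow> a5 = b5 \<Longrightarrow> a6 = b6 \<Longrightarrow> a7 = b7
    \<Longrightarrow> a8 = b8 \<Longrightarrow>
    lin a0 a1 a2 a3 a4 a5 a6 a7 a8 = lin b0 b1 b2 b3 b4 b5 b6 b7 b8"
  by simp

lemma sharp_lin:
  "sharp (lin c0 c1 c2 c3 c4 c5 c6 c7 c8) = lin
    (c0^2 - N1*N2*c6*c7 + S1*S2*T11*c6*c7 - T11*T22*c6*c7 + T12*T21*c6*c7 + N2*S1*c5*c6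
        + N1*S2*c5*c7 - N1*N2*c5*c8 - S1*S2*T11*c5*c8 + T11*T22*c5*c8 - T12*T21*c5*c8 - N2*T11*c4*c6
        - S2*T12*c4*c6 - N2*T21*c4*c8 + S1*S2^2*c4*c8 - S2*T22*c4*c8 - N2*c3*c4 - T12*c3*c5
        + S1*S2*c3*c7 - T22*c3*c7 - N1*T11*c2*c7 - S1*T21*c2*c7 - N1*T12*c2*c8 + S1^2*S2*c2*c8
        - S1*T22*c2*c8 - N1*c1*c2 - T21*c1*c5 + S1*S2*c1*c6 - T22*c1*c6 + S1*c0*c2 + S2*c0*c4
        - T11*c0*c5 - T12*c0*c6 - T21*c0*c7 + S1*S2*c0*c8 - T22*c0*c8)
    (N1*c2^2 + T12*c5^2 + N2*T11*c6^2 - N1*N2*c7*c8 + N2*T21*c6*c8 - S2*T11*c5*c6 + T22*c5*c7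
        - S2*T21*c5*c8 + N2*c4*c5 - S2*c3*c5 + N2*c3*c6 + T21*c2*c5 + T22*c2*c6 - N1*S2*c2*c8
        - S1*c1*c2 + T11*c1*c5 + T12*c1*c6 - c0*c1)
    (c1^2 + T22*c7^2 + N2*T21*c8^2 - N2*S1*c7*c8 - S2*T21*c7*c8 - S2*T11*c6*c7 + N2*T11*c6*c8
        - N2*c5*c6 + T12*c5*c7 + N2*c4*c7 - S2*c3*c7 + N2*c3*c8 + T21*c2*c7 - S1*S2*c2*c8
        + T22*c2*c8 - S2*c1*c6 + T11*c1*c7 + T12*c1*c8 - c0*c2)
    (N2*c4^2 + T21*c5^2 + N1*T11*c7^2 + N1*T12*c7*c8 - N1*N2*c6*c8 + T22*c5*c6 - S1*T11*c5*c7
        - S1*T12*c5*c8 + T12*c4*c5 + T22*c4*c7 - N2*S1*c4*c8 - S2*c3*c4 + T11*c3*c5 + T21*c3*c7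
        + N1*c2*c5 - S1*c1*c5 + N1*c1*c7 - c0*c3)
    (c3^2 + T22*c6^2 + N1*T12*c8^2 + N1*T11*c7*c8 - S1*T11*c6*c7 - N1*S2*c6*c8 - S1*T12*c6*c8
        + T21*c5*c6 - N1*c5*c7 + T12*c4*c6 - S1*S2*c4*c8 + T22*c4*c8 + T11*c3*c6 - S1*c3*c7
        + T21*c3*c8 + N1*c2*c6 - S1*c1*c6 + N1*c1*c8 - c0*c4)
    (N1*S2*c7*c8 - N1*N2*c8^2 - T22*c6*c7 + N2*S1*c6*c8 - S1*S2*c5*c8 + T22*c5*c8 - N2*c4*c6
        - N1*c2*c7 + c1*c3 - c0*c5)
    (T21*c6*c7 - N1*c7^2 + S1*c5*c7 - T21*c5*c8 - S2*c4*c6 - c3*c5 - N1*c2*c8 + c1*c4 - c0*c6)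
    (T12*c6*c7 - N2*c6^2 + S2*c5*c6 - T12*c5*c8 - N2*c4*c8 + c2*c3 - S1*c2*c7 - c1*c5 - c0*c7)
    (T11*c5*c8 - c5^2 - T11*c6*c7 - S2*c4*c8 - c3*c7 + c2*c4 - S1*c2*c8 - c1*c6 - c0*c8)"
  unfolding lin_def[of c0 c1 c2 c3 c4 c5 c6 c7 c8] sharp_combination[OF sharp_00 sharp_11 sharp_22
      sharp_33 sharp_44 sharp_55 sharp_66 sharp_77 sharp_88 cross_78 cross_67 cross_68 cross_56
      cross_57 cross_58 cross_45 cross_46 cross_47 cross_48 cross_34 cross_35 cross_36 cross_37
      cross_38 cross_23 cross_24 cross_25 cross_26 cross_27 cross_28 cross_12 cross_13 cross_14
      cross_15 cross_16 cross_17 cross_18 cross_01 cross_02 cross_03 cross_04 cross_05 cross_06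
      cross_07 cross_08]
  by (simp only: lin_scale lin_add, rule lin_cong) (simp_all add: algebra_simps power2_eq_square)

section \<open>The discriminant and linear independence\<close>

lemma trace_lin: "tr (lin c0 c1 c2 c3 c4 c5 c6 c7 c8) = 3 * c0 + S1 * c2 + S2 * c4 - T11 * c5
    - T12 * c6 - T21 * c7 + (S1*S2 - T22) * c8"
  by (simp add: normal_form)

text \<open>
  Traces of products are read off from the multiplication table, because
  \<open>T(w, z) = tr w tr z - tr (w \<diamondop> z)\<close>.
\<close>

lemma T_lin_via_cross:
  "T (lin c0 c1 c2 c3 c4 c5 c6 c7 c8) z = (3 * c0 + S1 * c2 + S2 * c4 - T11 * c5 - T12 * c6
      - T21 * c7 + (S1*S2 - T22) * c8) * tr z
    - tr ((scale c0 unt + scale c1 x + scale c2 (sharp x) + scale c3 y + scale c4 (sharp y)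
        + scale c5 (x \<diamondop> y)
      + scale c6 (x \<diamondop> sharp y) + scale c7 (sharp x \<diamondop> y) + scale c8 (sharp x \<diamondop> sharp y)) \<diamondop> z)"
  unfolding lin_def[symmetric] tr_cross trace_lin by simp

lemmas table = cross_12 cross_15 cross_16 cross_17 cross_18 cross_25 cross_26 cross_27 cross_28
    cross_34 cross_35 cross_36 cross_37 cross_38 cross_45 cross_46 cross_47 cross_48 cross_56
    cross_57 cross_58 cross_67 cross_68 cross_78
lemmas products = table table[THEN trans[OF cross_commute]] sharp_55 sharp_66 sharp_77 sharp_88

lemma
  shows T_lin1: "T (lin c0 c1 c2 c3 c4 c5 c6 c7 c8) x = - (2*S1) * c1 + 3*N1 * c2 + T11 * c3
      + T12 * c4 + 2*T21 * c5 + 2*T22 * c6 - S1*T11 * c7 - (N1*S2 + S1*T12) * c8"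
    and T_lin2: "T (lin c0 c1 c2 c3 c4 c5 c6 c7 c8) (sharp x) = S1 * c0 + 3*N1 * c1 + S1^2 * c2
        + T21 * c3 + T22 * c4 - S1*T11 * c5 - (N1*S2 + S1*T12) * c6 + 2*N1*T11 * c7 + 2*N1*T12 * c8"
    and T_lin3: "T (lin c0 c1 c2 c3 c4 c5 c6 c7 c8) y = T11 * c1 + T21 * c2 - 2*S2 * c3 + 3*N2 * c4
        + 2*T12 * c5 - S2*T11 * c6 + 2*T22 * c7 - (N2*S1 + S2*T21) * c8"
    and T_lin4: "T (lin c0 c1 c2 c3 c4 c5 c6 c7 c8) (sharp y) = S2 * c0 + T12 * c1 + T22 * c2
        + 3*N2 * c3 + S2^2 * c4 - S2*T11 * c5 + 2*N2*T11 * c6 - (N2*S1 + S2*T21) * c7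
        + 2*N2*T21 * c8"
    and T_lin5: "T (lin c0 c1 c2 c3 c4 c5 c6 c7 c8) (x \<diamondop> y) = - (T11) * c0 + 2*T21 * c1
        - S1*T11 * c2 + 2*T12 * c3 - S2*T11 * c4 + (2*S1*S2 + T11^2 - 2*T22) * c5 + (T11*T12
        - 2*N2*S1) * c6 + (T11*T21 - 2*N1*S2) * c7 + (3*N1*N2 + T12*T21) * c8"
    and T_lin6: "T (lin c0 c1 c2 c3 c4 c5 c6 c7 c8) (x \<diamondop> sharp y) = - (T12) * c0 + 2*T22 * c1
        - (N1*S2 + S1*T12) * c2 - S2*T11 * c3 + 2*N2*T11 * c4 + (T11*T12 - 2*N2*S1) * c5 + (T12^2
        - 2*N2*T21 - 2*S2*T22) * c6 + (3*N1*N2 + T11*T22) * c7 + (N1*S2^2 + T12*T22) * c8"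
    and T_lin7: "T (lin c0 c1 c2 c3 c4 c5 c6 c7 c8) (sharp x \<diamondop> y) = - (T21) * c0 - S1*T11 * c1
        + 2*N1*T11 * c2 + 2*T22 * c3 - (N2*S1 + S2*T21) * c4 + (T11*T21 - 2*N1*S2) * c5 + (3*N1*N2
        + T11*T22) * c6 + (T21^2 - 2*N1*T12 - 2*S1*T22) * c7 + (N2*S1^2 + T21*T22) * c8"
    and T_lin8: "T (lin c0 c1 c2 c3 c4 c5 c6 c7 c8) (sharp x \<diamondop> sharp y) = (S1*S2 - T22) * c0
        - (N1*S2 + S1*T12) * c1 + 2*N1*T12 * c2 - (N2*S1 + S2*T21) * c3 + 2*N2*T21 * c4 + (3*N1*N2
        + T12*T21) * c5 + (N1*S2^2 + T12*T22) * c6 + (N2*S1^2 + T21*T22) * c7 + (S1^2*S2^2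
        - 2*N1*N2*T11 - 2*N1*S2*T12 - 2*N2*S1*T21 - 2*S1*S2*T22 + T22^2) * c8"
  unfolding T_lin_via_cross
  by (simp_all only: cross_simps cross_simps_right products cross_self unt_cross T_simps trace_lin)
    (simp_all add: tr_cross normal_order sharp_sharp N_sharp algebra_simps power2_eq_square)

end

text \<open>
  The \<open>r\<^sub>j\<close> are the entries of \<open>G c\<close> for the Gram matrix \<open>G\<close>, and the coefficients in the
  conclusions are the rows of \<open>D G\<^sup>-\<^sup>1\<close> that belong to \<open>c\<^sub>1, \<dots>, c\<^sub>8\<close>. The coefficient \<open>c\<^sub>0\<close>
  of the unit is cheaper to get from the trace once the others vanish.
\<close>

lemma discriminant_rows:
  fixes N1 N2 S1 S2 T11 T12 T21 T22 c0 c1 c2 c3 c4 c5 c6 c7 c8 r0 r1 r2 r3 r4 r5 r6 r7 r8 ::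
      "'a::field"
  assumes r0: "r0 = 3 * c0 + S1 * c2 + S2 * c4 - T11 * c5 - T12 * c6 - T21 * c7 + (S1*S2
      - T22) * c8"
    and r1: "r1 = - (2*S1) * c1 + 3*N1 * c2 + T11 * c3 + T12 * c4 + 2*T21 * c5 + 2*T22 * c6
        - S1*T11 * c7 - (N1*S2 + S1*T12) * c8"
    and r2: "r2 = S1 * c0 + 3*N1 * c1 + S1^2 * c2 + T21 * c3 + T22 * c4 - S1*T11 * c5 - (N1*S2
        + S1*T12) * c6 + 2*N1*T11 * c7 + 2*N1*T12 * c8"
    and r3: "r3 = T11 * c1 + T21 * c2 - 2*S2 * c3 + 3*N2 * c4 + 2*T12 * c5 - S2*T11 * c6
        + 2*T22 * c7 - (N2*S1 + S2*T21) * c8"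
    and r4: "r4 = S2 * c0 + T12 * c1 + T22 * c2 + 3*N2 * c3 + S2^2 * c4 - S2*T11 * c5
        + 2*N2*T11 * c6 - (N2*S1 + S2*T21) * c7 + 2*N2*T21 * c8"
    and r5: "r5 = - (T11) * c0 + 2*T21 * c1 - S1*T11 * c2 + 2*T12 * c3 - S2*T11 * c4 + (2*S1*S2
        + T11^2 - 2*T22) * c5 + (T11*T12 - 2*N2*S1) * c6 + (T11*T21 - 2*N1*S2) * c7 + (3*N1*N2
        + T12*T21) * c8"
    and r6: "r6 = - (T12) * c0 + 2*T22 * c1 - (N1*S2 + S1*T12) * c2 - S2*T11 * c3 + 2*N2*T11 * c4
        + (T11*T12 - 2*N2*S1) * c5 + (T12^2 - 2*N2*T21 - 2*S2*T22) * c6 + (3*N1*N2 + T11*T22) * c7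
        + (N1*S2^2 + T12*T22) * c8"
    and r7: "r7 = - (T21) * c0 - S1*T11 * c1 + 2*N1*T11 * c2 + 2*T22 * c3 - (N2*S1 + S2*T21) * c4
        + (T11*T21 - 2*N1*S2) * c5 + (3*N1*N2 + T11*T22) * c6 + (T21^2 - 2*N1*T12 - 2*S1*T22) * c7
        + (N2*S1^2 + T21*T22) * c8"
    and r8: "r8 = (S1*S2 - T22) * c0 - (N1*S2 + S1*T12) * c1 + 2*N1*T12 * c2 - (N2*S1 + S2*T21) * c3
        + 2*N2*T21 * c4 + (3*N1*N2 + T12*T21) * c5 + (N1*S2^2 + T12*T22) * c6 + (N2*S1^2
        + T21*T22) * c7 + (S1^2*S2^2 - 2*N1*N2*T11 - 2*N1*S2*T12 - 2*N2*S1*T21 - 2*S1*S2*T22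
        + T22^2) * c8"
  shows "disc_D N1 N2 S1 S2 T11 T12 T21 T22 * c1 =
      (2*N1*N2*S2*T21 - 3*N1*N2^2*S1 - 4*N1*N2*T11*T12 - 2*N1*S1*S2^3 + 2*N1*S2^2*T22
          - 2*N1*S2*T12^2 + N2*S1^2*S2*T11 - N2*S1*T11*T22 - N2*S1*T12*T21) * r0 + (2*N2*T21*T22
          - 4*N1*N2*S2*T11 - 2*N1*S2^2*T12 - 2*N2^2*S1^2 - 2*N2*S1*S2*T21 - 2*S1*S2^2*T22
          + 2*S2*T22^2) * r1 + (9*N1*N2^2 + 2*N1*S2^3 - N2*S1*S2*T11 - N2*T11*T22 - N2*T12*T21
          - 2*S2*T12*T22) * r2 + (2*N1*N2*S1*S2 + 4*N1*N2*T11^2 - 3*N1*N2*T22 + 2*N1*S2*T11*T12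
          + 2*N2*S1*T11*T21 + S1*S2*T11*T22 - T11*T22^2 + T12*T21*T22) * r3 + (2*N1*S1*S2^2
          - 3*N1*N2*T21 + 2*N1*S2*T11^2 - 4*N1*S2*T22 + 4*N1*T12^2 + S1*S2*T11*T21 + 2*S1*T12*T22
          + T11*T21*T22 - T12*T21^2) * r4 + (2*N1*S2^2*T11 - 6*N1*N2*T12 - 2*N2*S1*T22 + 2*N2*T21^2
          + 2*S2*T21*T22) * r5 + (2*T22^2 - 6*N1*N2*T11 - 2*N1*S2*T12 - 2*N2*S1*T21
          - 2*S1*S2*T22) * r6 + (3*N1*N2*S2 - 2*N2*S1*T12 - 2*N2*T11*T21 + S1*S2^2*T11 - S2*T11*T22
          - S2*T12*T21) * r7 + (2*N1*S2^2 - 2*N2*S1*T11 - 2*T12*T22) * r8"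
    and "disc_D N1 N2 S1 S2 T11 T12 T21 T22 * c2 =
      (2*N1*N2*S2*T11 + 2*N1*S2^2*T12 - 2*N2^2*S1^2 + 6*N2*S1*S2*T21 - 2*N2*S1*T11*T12
          - 4*N2*T21*T22 - 2*S1^2*S2^3 + 4*S1*S2^2*T22 - 2*S1*S2*T12^2 - 2*S2*T22^2) * r0
          + (9*N1*N2^2 + 2*N1*S2^3 - N2*S1*S2*T11 - N2*T11*T22 - N2*T12*T21 - 2*S2*T12*T22) * r1
          + (6*N2^2*S1 - 4*N2*S2*T21 + 2*N2*T11*T12 + 2*S1*S2^3 - 2*S2^2*T22 + 2*S2*T12^2) * r2
          + (2*N2*S1^2*S2 - 3*N1*N2*T12 + 2*N2*S1*T11^2 - 4*N2*S1*T22 + 4*N2*T21^2 + S1*S2*T11*T12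
          + 2*S2*T21*T22 + T11*T12*T22 - T12^2*T21) * r3 + (2*S1^2*S2^2 - 3*N1*N2*T11 - 4*N1*S2*T12
          - 4*N2*S1*T21 + S1*S2*T11^2 - 6*S1*S2*T22 + 2*S1*T12^2 + 2*S2*T21^2 - T11^2*T22
          + T11*T12*T21 + 4*T22^2) * r4 + (3*N1*N2*S2 - 2*N2*S1*T12 - 2*N2*T11*T21 + S1*S2^2*T11
          - S2*T11*T22 - S2*T12*T21) * r5 + (2*N1*S2^2 - 2*N2*S1*T11 - 2*T12*T22) * r6 + (4*N2*S1*S2
          + 2*N2*T11^2 - 6*N2*T22 + 2*S2^2*T21 + 2*S2*T11*T12) * r7 + (2*S1*S2^2 - 6*N2*T21
          - 2*S2*T22 + 2*T12^2) * r8"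
    and "disc_D N1 N2 S1 S2 T11 T12 T21 T22 * c3 =
      (2*N1*N2*S1*T12 - 3*N1^2*N2*S2 - 4*N1*N2*T11*T21 + N1*S1*S2^2*T11 - N1*S2*T11*T22
          - N1*S2*T12*T21 - 2*N2*S1^3*S2 + 2*N2*S1^2*T22 - 2*N2*S1*T21^2) * r0 + (2*N1*N2*S1*S2
          + 4*N1*N2*T11^2 - 3*N1*N2*T22 + 2*N1*S2*T11*T12 + 2*N2*S1*T11*T21 + S1*S2*T11*T22
          - T11*T22^2 + T12*T21*T22) * r1 + (2*N2*S1^2*S2 - 3*N1*N2*T12 + 2*N2*S1*T11^2
          - 4*N2*S1*T22 + 4*N2*T21^2 + S1*S2*T11*T12 + 2*S2*T21*T22 + T11*T12*T22 - T12^2*T21) * r2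
          + (2*N1*T12*T22 - 2*N1^2*S2^2 - 4*N1*N2*S1*T11 - 2*N1*S1*S2*T12 - 2*N2*S1^2*T21
          - 2*S1^2*S2*T22 + 2*S1*T22^2) * r3 + (9*N1^2*N2 - N1*S1*S2*T11 - N1*T11*T22 - N1*T12*T21
          + 2*N2*S1^3 - 2*S1*T21*T22) * r4 + (2*N1*T12^2 - 6*N1*N2*T21 - 2*N1*S2*T22 + 2*N2*S1^2*T11
          + 2*S1*T12*T22) * r5 + (3*N1*N2*S1 - 2*N1*S2*T21 - 2*N1*T11*T12 + S1^2*S2*T11 - S1*T11*T22
          - S1*T12*T21) * r6 + (2*T22^2 - 6*N1*N2*T11 - 2*N1*S2*T12 - 2*N2*S1*T21
          - 2*S1*S2*T22) * r7 + (2*N2*S1^2 - 2*N1*S2*T11 - 2*T21*T22) * r8"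
    and "disc_D N1 N2 S1 S2 T11 T12 T21 T22 * c4 =
      (2*N1*N2*S1*T11 - 2*N1^2*S2^2 + 6*N1*S1*S2*T12 - 2*N1*S2*T11*T21 - 4*N1*T12*T22
          + 2*N2*S1^2*T21 - 2*S1^3*S2^2 + 4*S1^2*S2*T22 - 2*S1*S2*T21^2 - 2*S1*T22^2) * r0
          + (2*N1*S1*S2^2 - 3*N1*N2*T21 + 2*N1*S2*T11^2 - 4*N1*S2*T22 + 4*N1*T12^2 + S1*S2*T11*T21
          + 2*S1*T12*T22 + T11*T21*T22 - T12*T21^2) * r1 + (2*S1^2*S2^2 - 3*N1*N2*T11 - 4*N1*S2*T12
          - 4*N2*S1*T21 + S1*S2*T11^2 - 6*S1*S2*T22 + 2*S1*T12^2 + 2*S2*T21^2 - T11^2*T22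
          + T11*T12*T21 + 4*T22^2) * r2 + (9*N1^2*N2 - N1*S1*S2*T11 - N1*T11*T22 - N1*T12*T21
          + 2*N2*S1^3 - 2*S1*T21*T22) * r3 + (6*N1^2*S2 - 4*N1*S1*T12 + 2*N1*T11*T21 + 2*S1^3*S2
          - 2*S1^2*T22 + 2*S1*T21^2) * r4 + (3*N1*N2*S1 - 2*N1*S2*T21 - 2*N1*T11*T12 + S1^2*S2*T11
          - S1*T11*T22 - S1*T12*T21) * r5 + (4*N1*S1*S2 + 2*N1*T11^2 - 6*N1*T22 + 2*S1^2*T12
          + 2*S1*T11*T21) * r6 + (2*N2*S1^2 - 2*N1*S2*T11 - 2*T21*T22) * r7 + (2*S1^2*S2 - 6*N1*T12
          - 2*S1*T22 + 2*T21^2) * r8"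
    and "disc_D N1 N2 S1 S2 T11 T12 T21 T22 * c5 =
      (2*N1*N2*T11^2 - 5*N1*N2*S1*S2 + 3*N1*N2*T22 + 2*N1*S2*T11*T12 + 2*N2*S1*T11*T21
          - S1^2*S2^2*T11 + 2*S1*S2*T11*T22 + S1*S2*T12*T21 - T11*T22^2 + T12*T21*T22) * r0
          + (2*N1*S2^2*T11 - 6*N1*N2*T12 - 2*N2*S1*T22 + 2*N2*T21^2 + 2*S2*T21*T22) * r1
          + (3*N1*N2*S2 - 2*N2*S1*T12 - 2*N2*T11*T21 + S1*S2^2*T11 - S2*T11*T22 - S2*T12*T21) * r2
          + (2*N1*T12^2 - 6*N1*N2*T21 - 2*N1*S2*T22 + 2*N2*S1^2*T11 + 2*S1*T12*T22) * r3
          + (3*N1*N2*S1 - 2*N1*S2*T21 - 2*N1*T11*T12 + S1^2*S2*T11 - S1*T11*T22 - S1*T12*T21) * r4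
          + (6*N1*N2*T11 + 2*N1*S2*T12 + 2*N2*S1*T21 + 2*S1*S2*T22 - 2*T22^2) * r5 + (2*N1*S2*T11
          - 2*N2*S1^2 + 2*T21*T22) * r6 + (2*N2*S1*T11 - 2*N1*S2^2 + 2*T12*T22) * r7 + (9*N1*N2
          + S1*S2*T11 - T11*T22 - T12*T21) * r8"
    and "disc_D N1 N2 S1 S2 T11 T12 T21 T22 * c6 =
      (3*N1*N2*T21 - 4*N1*S1*S2^2 + 4*N1*S2*T22 + 2*N1*T12^2 - 2*S1^2*S2*T12 - S1*S2*T11*T21
          + 2*S1*T12*T22 + T11*T21*T22 - T12*T21^2) * r0 + (2*T22^2 - 6*N1*N2*T11 - 2*N1*S2*T12
          - 2*N2*S1*T21 - 2*S1*S2*T22) * r1 + (2*N1*S2^2 - 2*N2*S1*T11 - 2*T12*T22) * r2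
          + (3*N1*N2*S1 - 2*N1*S2*T21 - 2*N1*T11*T12 + S1^2*S2*T11 - S1*T11*T22 - S1*T12*T21) * r3
          + (4*N1*S1*S2 + 2*N1*T11^2 - 6*N1*T22 + 2*S1^2*T12 + 2*S1*T11*T21) * r4 + (2*N1*S2*T11
          - 2*N2*S1^2 + 2*T21*T22) * r5 + (6*N1*T12 - 2*S1^2*S2 + 2*S1*T22 - 2*T21^2) * r6
          + (9*N1*N2 + S1*S2*T11 - T11*T22 - T12*T21) * r7 + (6*N1*S2 + 2*S1*T12 + 2*T11*T21) * r8"
    and "disc_D N1 N2 S1 S2 T11 T12 T21 T22 * c7 =
      (3*N1*N2*T12 - 4*N2*S1^2*S2 + 4*N2*S1*T22 + 2*N2*T21^2 - 2*S1*S2^2*T21 - S1*S2*T11*T12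
          + 2*S2*T21*T22 + T11*T12*T22 - T12^2*T21) * r0 + (3*N1*N2*S2 - 2*N2*S1*T12 - 2*N2*T11*T21
          + S1*S2^2*T11 - S2*T11*T22 - S2*T12*T21) * r1 + (4*N2*S1*S2 + 2*N2*T11^2 - 6*N2*T22
          + 2*S2^2*T21 + 2*S2*T11*T12) * r2 + (2*T22^2 - 6*N1*N2*T11 - 2*N1*S2*T12 - 2*N2*S1*T21
          - 2*S1*S2*T22) * r3 + (2*N2*S1^2 - 2*N1*S2*T11 - 2*T21*T22) * r4 + (2*N2*S1*T11
          - 2*N1*S2^2 + 2*T12*T22) * r5 + (9*N1*N2 + S1*S2*T11 - T11*T22 - T12*T21) * r6 + (6*N2*T21
          - 2*S1*S2^2 + 2*S2*T22 - 2*T12^2) * r7 + (6*N2*S1 + 2*S2*T21 + 2*T11*T12) * r8"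
    and "disc_D N1 N2 S1 S2 T11 T12 T21 T22 * c8 =
      (3*N1*N2*T11 + 4*N1*S2*T12 + 4*N2*S1*T21 - 2*S1^2*S2^2 + S1*S2*T11^2 - T11^2*T22 + T11*T12*T21
          + 2*T22^2) * r0 + (2*N1*S2^2 - 2*N2*S1*T11 - 2*T12*T22) * r1 + (2*S1*S2^2 - 6*N2*T21
          - 2*S2*T22 + 2*T12^2) * r2 + (2*N2*S1^2 - 2*N1*S2*T11 - 2*T21*T22) * r3 + (2*S1^2*S2
          - 6*N1*T12 - 2*S1*T22 + 2*T21^2) * r4 + (9*N1*N2 + S1*S2*T11 - T11*T22 - T12*T21) * r5
          + (6*N1*S2 + 2*S1*T12 + 2*T11*T21) * r6 + (6*N2*S1 + 2*S2*T21 + 2*T11*T12) * r7 + (2*S1*S2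
          - 2*T11^2 + 6*T22) * r8"
  unfolding disc_D_def assms by Groebner_Basis.algebra+

context traceless_pair
begin

lemma lin_eq_0_iff:
  assumes "disc_D N1 N2 S1 S2 T11 T12 T21 T22 \<noteq> 0"
  shows "lin c0 c1 c2 c3 c4 c5 c6 c7 c8 = 0 \<longleftrightarrow> c0 = 0 \<and> c1 = 0 \<and> c2 = 0 \<and> c3 = 0 \<and> c4 = 0 \<and> c5 = 0
      \<and> c6 = 0 \<and> c7 = 0 \<and> c8 = 0"
proof
  assume "lin c0 c1 c2 c3 c4 c5 c6 c7 c8 = 0"
  then have "T (lin c0 c1 c2 c3 c4 c5 c6 c7 c8) z = 0" for z by simp
  \<comment> \<open>the nine relations in the form in which they are the hypotheses of \<open>discriminant_rows\<close>\<close>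
  note zero = this[of unt, unfolded trace_lin, symmetric] this[of x, unfolded T_lin1, symmetric]
      this[of "sharp x", unfolded T_lin2, symmetric] this[of y, unfolded T_lin3, symmetric] this[of
      "sharp y", unfolded T_lin4, symmetric] this[of "x \<diamondop> y", unfolded T_lin5, symmetric] this[of "x
      \<diamondop> sharp y", unfolded T_lin6, symmetric] this[of "sharp x \<diamondop> y", unfolded T_lin7, symmetric]
      this[of "sharp x \<diamondop> sharp y", unfolded T_lin8, symmetric]
  have "c1 = 0 \<and> c2 = 0 \<and> c3 = 0 \<and> c4 = 0 \<and> c5 = 0 \<and> c6 = 0 \<and> c7 = 0 \<and> c8 = 0"
    using discriminant_rows[OF zero] assms by simp
  moreover from this have "c0 = 0"
    using zero(1) three by simp
  ultimately show "c0 = 0 \<and> c1 = 0 \<and> c2 = 0 \<and> c3 = 0 \<and> c4 = 0 \<and> c5 = 0 \<and> c6 = 0 \<and> c7 = 0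
      \<and> c8 = 0" by simp
qed (simp add: lin_def)

lemma lin_inject:
  assumes disc: "disc_D N1 N2 S1 S2 T11 T12 T21 T22 \<noteq> 0"
  shows "lin a0 a1 a2 a3 a4 a5 a6 a7 a8 = lin b0 b1 b2 b3 b4 b5 b6 b7 b8 \<longleftrightarrow>
    a0 = b0 \<and> a1 = b1 \<and> a2 = b2 \<and> a3 = b3 \<and> a4 = b4 \<and> a5 = b5 \<and> a6 = b6 \<and> a7 = b7 \<and> a8 = b8"
proof -
  have "lin a0 a1 a2 a3 a4 a5 a6 a7 a8 - lin b0 b1 b2 b3 b4 b5 b6 b7 b8
      = lin (a0 - b0) (a1 - b1) (a2 - b2) (a3 - b3) (a4 - b4) (a5 - b5) (a6 - b6) (a7 - b7) (a8
          - b8)"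
    by (simp add: lin_def algebra_simps)
  then show ?thesis
    using lin_eq_0_iff[OF disc] by (metis right_minus_eq)
qed

end

section \<open>The adapted basis\<close>

text \<open>
  The left-hand sides are the nine coordinates in \<open>sharp_lin\<close>. They are taken at the
  coordinates \<open>c\<^sub>0, \<dots>, c\<^sub>8\<close> of \<open>t\<^sub>1\<^sub>3\<^sub>5\<close> times a combination of the adapted basis, with the
  eight invariants written in the parameters \<open>t\<close>. The factor in parentheses on the right is
  the corresponding coordinate of \<open>t\<^sub>1\<^sub>3\<^sub>5\<close> times the claimed value of \<open>sharp\<close>; the other
  factor \<open>t\<^sub>1\<^sub>3\<^sub>5\<close> appears because \<open>sharp\<close> is quadratic. Clearing the denominator \<open>t\<^sub>1\<^sub>3\<^sub>5\<close>
  in this way makes everything polynomial. The letter \<open>c\<close> stands for a third of \<open>S(\<upsilon>\<^sub>1)\<close>.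
\<close>

lemma sharp_coordinates_polynomial:
  fixes t1 t2 t123 t124 t125 t126 t135 t136 t245 t246
    p1 p2 p3 p4 u1 u2 s1 s2 s3
    adp1 adp2 adp3 adp4 adu1 adu2 ads1 ads2 ads3
    d U1 U2 U3 I1 I2 I3 A1 A2 A3 \<alpha> \<beta> \<gamma> a0 a1 a2 b0 b1 b2 F1 F2 F3 F4 F5 F6 F7 F8 F9
    c N1 N2 S1 S2 T11 T12 T21 T22 c0 c1 c2 c3 c4 c5 c6 c7 c8 :: "'a::field"
  assumes "d = p1 * p4 - p2 * p3"
    and "U1 = p1^2 + t1 * p2^2 + p2 * u1"
    and "U2 = 2 * p1 * p3 + 2 * t1 * p2 * p4 + p4 * u1 + p2 * u2"
    and "U3 = p3^2 + t1 * p4^2 + p4 * u2"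
    and "I1 = t2 * p2^2 + p1 * u1"
    and "I2 = 2 * t2 * p2 * p4 + p3 * u1 + p1 * u2"
    and "I3 = t2 * p4^2 + p3 * u2"
    and "A1 = t1 * p2 * u1 - t2 * p1 * p2 + u1^2"
    and "A2 = t1 * (p4 * u1 + p2 * u2) - t2 * (p2 * p3 + p1 * p4) + 2 * u1 * u2"
    and "A3 = t1 * p4 * u2 - t2 * p3 * p4 + u2^2"
    and "\<alpha> = t136^2 - t135 * t245"
    and "\<beta> = t135 * t246 - t136 * t245"
    and "\<gamma> = t245^2 - t136 * t246"
    and "a0 = t123 * t136 - t124 * t135"
    and "a1 = t123 * t245 - t124 * t136"
    and "a2 = t123 * t246 - t124 * t245"
    and "b0 = t125 * t136 - t126 * t135"
    and "b1 = t125 * t245 - t126 * t136"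
    and "b2 = t125 * t246 - t126 * t245"
    and "F1 = u1 * s1 - p1 * s2 - p2 * s3 - t126 * d - (t136 * U1 + t245 * U2 + t246 * U3)"
    and "F2 = u2 * s1 - p3 * s2 - p4 * s3 + t125 * d + t135 * U1 + t136 * U2 + t245 * U3"
    and "F3 = - t2 * p2 * s1 + (t1 * p2 + u1) * s2 - p1 * s3 - t124 * d - (t136 * I1 + t245 * I2
        + t246 * I3)"
    and "F4 = - t2 * p4 * s1 + (t1 * p4 + u2) * s2 - p3 * s3 + t123 * d + t135 * I1 + t136 * I2
        + t245 * I3"
    and "F5 = - t2 * p1 * s1 + (t1 * p1 - t2 * p2) * s2 + (t1 * p2 + u1) * s3 + t123 * U1
        + t124 * (p1 * p3 + t1 * p2 * p4 + p2 * u2) - t125 * I1 - t126 * (t2 * p2 * p4 + p1 * u2)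
        - (t136 * A1 + t245 * A2 + t246 * A3)"
    and "F6 = - t2 * p3 * s1 + (t1 * p3 - t2 * p4) * s2 + (t1 * p4 + u2) * s3 + t123 * (p1 * p3
        + t1 * p2 * p4 + p4 * u1) + t124 * U3 - t125 * (t2 * p2 * p4 + p3 * u1) - t126 * I3
        + t135 * A1 + t136 * A2 + t245 * A3"
    and "F7 = s1 * s3 - s2^2 + (t123 * p2 + t124 * p4) * s1 - (t125 * p2 + t126 * p4) * s2
        + \<alpha> * (p1^2 - 2 * p2 * u1 - t1 * p2^2) + \<gamma> * (p3^2 - 2 * p4 * u2 - t1 * p4^2) + \<beta> * (p2 * u2
        + p4 * u1 - p1 * p3 + t1 * p2 * p4) + a0 * p2^2 + 2 * a1 * p2 * p4 + a2 * p4^2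
        - b0 * p1 * p2 - b1 * (p1 * p4 + p2 * p3) - b2 * p3 * p4"
    and "F8 = s2 * s3 + t1 * s1 * s2 - t2 * s1^2 + (t123 * p1 + t124 * p3) * s1 - (t125 * p1
        + t126 * p3) * s2 + \<alpha> * (-2 * p1 * u1 - 2 * t1 * p1 * p2 + t2 * p2^2) + \<gamma> * (-2 * p3 * u2
        - 2 * t1 * p3 * p4 + t2 * p4^2) + \<beta> * (p1 * u2 + p3 * u1 + t1 * (p1 * p4
        + p2 * p3)-t2 * p2 * p4) - b0 * p1^2 - 2 * b1 * p1 * p3 - b2 * p3^2 + a0 * p1 * p2
        + a1 * (p1 * p4 + p2 * p3) + a2 * p3 * p4"
    and "F9 = s3^2 + t1 * s2^2 - t2 * s1 * s2 + (t123 * u1 + t124 * u2) * s1 - (t125 * u1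
        + t126 * u2) * s2 - \<alpha> * (2 * t2 * p1 * p2 + u1^2) + \<beta> * (t2 * (p2 * p3 + p1 * p4)+u1 * u2)
        - \<gamma> * (2 * t2 * p3 * p4 + u2^2) - t1 * (a0 * p2^2 + 2 * a1 * p2 * p4 + a2 * p4^2)
        + t2 * (b0 * p2^2 + 2 * b1 * p2 * p4 + b2 * p4^2) - a0 * p1^2 - 2 * a1 * p1 * p3 - a2 * p3^2
        + (t124 * t125 - t123 * t126) * d"
    and "adp1 = F3"
    and "adp2 = F1"
    and "adp3 = F4"
    and "adp4 = F2"
    and "adu1 = - F5 - t1 * adp2"
    and "adu2 = - F6 - t1 * adp4"
    and "ads1 = - F7"
    and "ads2 = - F8"
    and "ads3 = F9 - t1 * ads1 + t125 * adp1 - t123 * adp2 + t126 * adp3 - t124 * adp4"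
    and "c = t135*t245 - t136^2"
    and "N1 = t2"
    and "S1 = t1"
    and "S2 = 3*c"
    and "N2 = t135^2*t246 + 2*t136^3 - 3*t135*t136*t245"
    and "T11 = t125"
    and "T12 = t136*t125 - t135*t126"
    and "T21 = - t123"
    and "T22 = - t136*t123 + t135*t124 + c*t1"
    and "c0 = t135*s3 + c*u2 + 2*c*t1*p4"
    and "c1 = t135*s2 - c*p3"
    and "c2 = t135*s1 - c*p4"
    and "c3 = t135*u1 + t135*t1*p2 + t136*u2 + t136*t1*p4"
    and "c4 = - u2 - t1*p4"
    and "c5 = t135*p1 + t136*p3"
    and "c6 = - p3"
    and "c7 = t135*p2 + t136*p4"
    and "c8 = - p4"
  shows "c0^2 - N1*N2*c6*c7 + S1*S2*T11*c6*c7 - T11*T22*c6*c7 + T12*T21*c6*c7 + N2*S1*c5*c6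
      + N1*S2*c5*c7 - N1*N2*c5*c8 - S1*S2*T11*c5*c8 + T11*T22*c5*c8 - T12*T21*c5*c8 - N2*T11*c4*c6
      - S2*T12*c4*c6 - N2*T21*c4*c8 + S1*S2^2*c4*c8 - S2*T22*c4*c8 - N2*c3*c4 - T12*c3*c5
      + S1*S2*c3*c7 - T22*c3*c7 - N1*T11*c2*c7 - S1*T21*c2*c7 - N1*T12*c2*c8 + S1^2*S2*c2*c8
      - S1*T22*c2*c8 - N1*c1*c2 - T21*c1*c5 + S1*S2*c1*c6 - T22*c1*c6 + S1*c0*c2 + S2*c0*c4
      - T11*c0*c5 - T12*c0*c6 - T21*c0*c7 + S1*S2*c0*c8 - T22*c0*c8
      = t135 * (t135*ads3 + c*adu2 + 2*c*t1*adp4)"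
    and "N1*c2^2 + T12*c5^2 + N2*T11*c6^2 - N1*N2*c7*c8 + N2*T21*c6*c8 - S2*T11*c5*c6 + T22*c5*c7
        - S2*T21*c5*c8 + N2*c4*c5 - S2*c3*c5 + N2*c3*c6 + T21*c2*c5 + T22*c2*c6 - N1*S2*c2*c8
        - S1*c1*c2 + T11*c1*c5 + T12*c1*c6 - c0*c1
      = t135 * (t135*ads2 - c*adp3)"
    and "c1^2 + T22*c7^2 + N2*T21*c8^2 - N2*S1*c7*c8 - S2*T21*c7*c8 - S2*T11*c6*c7 + N2*T11*c6*c8
        - N2*c5*c6 + T12*c5*c7 + N2*c4*c7 - S2*c3*c7 + N2*c3*c8 + T21*c2*c7 - S1*S2*c2*c8
        + T22*c2*c8 - S2*c1*c6 + T11*c1*c7 + T12*c1*c8 - c0*c2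
      = t135 * (t135*ads1 - c*adp4)"
    and "N2*c4^2 + T21*c5^2 + N1*T11*c7^2 + N1*T12*c7*c8 - N1*N2*c6*c8 + T22*c5*c6 - S1*T11*c5*c7
        - S1*T12*c5*c8 + T12*c4*c5 + T22*c4*c7 - N2*S1*c4*c8 - S2*c3*c4 + T11*c3*c5 + T21*c3*c7
        + N1*c2*c5 - S1*c1*c5 + N1*c1*c7 - c0*c3
      = t135 * (t135*adu1 + t135*t1*adp2 + t136*adu2 + t136*t1*adp4)"
    and "c3^2 + T22*c6^2 + N1*T12*c8^2 + N1*T11*c7*c8 - S1*T11*c6*c7 - N1*S2*c6*c8 - S1*T12*c6*c8
        + T21*c5*c6 - N1*c5*c7 + T12*c4*c6 - S1*S2*c4*c8 + T22*c4*c8 + T11*c3*c6 - S1*c3*c7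
        + T21*c3*c8 + N1*c2*c6 - S1*c1*c6 + N1*c1*c8 - c0*c4
      = t135 * (- adu2 - t1*adp4)"
    and "N1*S2*c7*c8 - N1*N2*c8^2 - T22*c6*c7 + N2*S1*c6*c8 - S1*S2*c5*c8 + T22*c5*c8 - N2*c4*c6
        - N1*c2*c7 + c1*c3 - c0*c5
      = t135 * (t135*adp1 + t136*adp3)"
    and "T21*c6*c7 - N1*c7^2 + S1*c5*c7 - T21*c5*c8 - S2*c4*c6 - c3*c5 - N1*c2*c8 + c1*c4 - c0*c6
      = t135 * (- adp3)"
    and "T12*c6*c7 - N2*c6^2 + S2*c5*c6 - T12*c5*c8 - N2*c4*c8 + c2*c3 - S1*c2*c7 - c1*c5 - c0*c7
      = t135 * (t135*adp2 + t136*adp4)"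
    and "T11*c5*c8 - c5^2 - T11*c6*c7 - S2*c4*c8 - c3*c7 + c2*c4 - S1*c2*c8 - c1*c6 - c0*c8
      = t135 * (- adp4)"
  unfolding assms by Groebner_Basis.algebra+

locale adapted_pair = traceless_pair +
  fixes u :: 'b and t135 t136 t245 t246 :: 'a
  assumes disc: "disc_D (N x) (N y) (S x) (S y) (T x y) (T x (sharp y)) (T (sharp x) y) (T (sharp x)
      (sharp y)) \<noteq> 0"
    and sharp_y: "sharp y = scale t136 y - scale t135 u + scale (1 / 3 * S y) unt"
    and sharp_u: "sharp u = scale t246 y - scale t245 u + scale (1 / 3 * S u) unt"
begin

abbreviation "t1 \<equiv> S x"
abbreviation "t2 \<equiv> N x"
abbreviation "t123 \<equiv> - T (sharp x) y"
abbreviation "t124 \<equiv> - T (sharp x) u"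
abbreviation "t125 \<equiv> T x y"
abbreviation "t126 \<equiv> T x u"
abbreviation "c \<equiv> t135 * t245 - t136\<^sup>2"

lemma scale_u_S: "scale t135 u = lin (1 / 3 * S y) 0 0 t136 (-1) 0 0 0 0"
proof -
  \<comment> \<open>\<open>S y\<close> contains \<open>sharp y\<close>, so the given equation would rewrite its own right-hand side\<close>
  define k where "k = 1 / 3 * S y"
  have "sharp y = scale t136 y - scale t135 u + scale k unt"
    unfolding k_def by (rule sharp_y)
  then have "scale t135 u = scale k unt + scale t136 y - sharp y"
    by (simp add: algebra_simps)
  then show ?thesis
    unfolding k_def[symmetric] by (simp add: lin_def)
qed

text \<open>
  Otherwise \<open>y\<^sup>#\<close> would be a combination of \<open>y\<close> and the unit.
\<close>

lemma t135_nonzero: "t135 \<noteq> 0"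
proof
  assume "t135 = 0"
  then have "lin (1 / 3 * S y) 0 0 t136 (-1) 0 0 0 0 = lin 0 0 0 0 0 0 0 0 0"
    using scale_u_S by (simp add: lin_def)
  then show False unfolding lin_inject[OF disc] by simp
qed

text \<open>
  Compute \<open>(t\<^sub>1\<^sub>3\<^sub>5 u)\<^sup>#\<close> twice, from the coordinates of \<open>t\<^sub>1\<^sub>3\<^sub>5 u\<close> and from the given
  formula for \<open>u\<^sup>#\<close>. The coordinates at \<open>y\<^sup>#\<close> and at \<open>y\<close> give the two equations.
\<close>

lemma S_y: "S y = 3 * c" and N_y: "N y = t135\<^sup>2 * t246 + 2 * t136 ^ 3 - 3 * t135 * t136 * t245"
proof -
  define k where "k = 1 / 3 * S y"
  have S_y_k: "S y = 3 * k" using three by (simp add: k_def)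
  have "scale (t135\<^sup>2) (sharp u) = sharp (scale t135 u)"
    by (simp add: sharp_scale)
  also have "\<dots> = lin (k\<^sup>2 - N y * t136 * -1 + S y * k * -1) 0 0 (N y - S y * t136 * -1
      - k * t136) (t136\<^sup>2 + k) 0 0 0 0"
    unfolding scale_u_S k_def[symmetric] sharp_lin by (rule lin_cong) (simp_all add: algebra_simps
        power2_eq_square)
  finally have l: "scale (t135\<^sup>2) (sharp u) = \<dots>" .
  define g where "g = 1 / 3 * S u"
  have "sharp u = scale t246 y - scale t245 u + scale g unt"
    unfolding g_def by (rule sharp_u)
  then have "scale (t135\<^sup>2) (sharp u) = scale (t135\<^sup>2 * t246) y - scale (t135 * t245) (scale t135 u)
      + scale (t135\<^sup>2 * g) unt"
    by (simp add: scale_right_distrib scale_right_diff_distrib power2_eq_square mult.commute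
        mult.left_commute)
  also have "\<dots> = lin (t135\<^sup>2 * g - t135 * t245 * k) 0 0 (t135\<^sup>2 * t246
      - t135 * t245 * t136) (t135 * t245) 0 0 0 0"
    unfolding scale_u_S k_def[symmetric] by (simp add: lin_def algebra_simps)
  finally have eqs: "N y - S y * t136 * -1 - k * t136 = t135\<^sup>2 * t246 - t135 * t245 * t136" "t136\<^sup>2
      + k = t135 * t245"
    unfolding l lin_inject[OF disc] by simp_all
  from eqs(2) have k: "k = c" by (simp add: algebra_simps)
  show "S y = 3 * c" using S_y_k k by simp
  have "N y = t135\<^sup>2 * t246 - t135 * t245 * t136 - 2 * k * t136"
    using eqs(1) unfolding S_y_k by (simp add: algebra_simps)
  then show "N y = t135\<^sup>2 * t246 + 2 * t136 ^ 3 - 3 * t135 * t136 * t245"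
    unfolding k by (simp add: algebra_simps power2_eq_square power3_eq_cube)
qed

lemma scale_u: "scale t135 u = lin c 0 0 t136 (-1) 0 0 0 0"
proof -
  have k: "1 / 3 * S y = c"
    by (simp only: S_y times_divide_eq_left mult_1 nonzero_mult_div_cancel_left[OF three])
  show ?thesis using scale_u_S unfolding k .
qed

lemma T_x_sharp_y: "T x (sharp y) = t136 * t125 - t135 * t126"
  and T_sharp_x_sharp_y: "T (sharp x) (sharp y) = - t136 * t123 + t135 * t124 + c * t1"
proof -
  have *: "sharp y = scale t136 y - scale t135 u + scale c unt"
    unfolding scale_u by (simp add: lin_def)
  show "T x (sharp y) = t136 * t125 - t135 * t126"
    unfolding * by simp
  show "T (sharp x) (sharp y) = - t136 * t123 + t135 * t124 + c * t1"
    unfolding * by simp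
qed

definition comb :: "'a \<Rightarrow> 'a \<Rightarrow> 'a \<Rightarrow> 'a \<Rightarrow> 'a \<Rightarrow> 'a \<Rightarrow> 'a \<Rightarrow> 'a \<Rightarrow> 'a \<Rightarrow> 'b" where
  "comb p1 p2 p3 p4 u1 u2 s1 s2 s3 =
    scale p1 (x \<diamondop> y) + scale p2 (sharp x \<diamondop> y + scale t1 y)
    + scale p3 (x \<diamondop> u) + scale p4 (sharp x \<diamondop> u + scale t1 u)
    + scale u1 y + scale u2 u + scale s1 (sharp x) + scale s2 x + scale s3 unt"

lemma scale_comb: "scale t135 (comb p1 p2 p3 p4 u1 u2 s1 s2 s3) = lin
    (t135*s3 + c*u2 + 2*c*t1*p4)
    (t135*s2 - c*p3)
    (t135*s1 - c*p4)
    (t135*u1 + t135*t1*p2 + t136*u2 + t136*t1*p4)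
    (- u2 - t1*p4)
    (t135*p1 + t136*p3)
    (- p3)
    (t135*p2 + t136*p4)
    (- p4)"
proof -
  have cross_u: "scale t135 (z \<diamondop> u) = z \<diamondop> lin c 0 0 t136 (-1) 0 0 0 0" for z
    by (simp flip: scale_u)
  \<comment> \<open>the factor \<open>t135\<close> is moved to where \<open>u\<close> occurs, since only \<open>t135 u\<close> has polynomial coordinates\<close>
  have "scale t135 (comb p1 p2 p3 p4 u1 u2 s1 s2 s3) =
      scale (t135 * p1) (x \<diamondop> y) + scale (t135 * p2) (sharp x \<diamondop> y) + scale (t135 * p2 * t1) y
      + scale p3 (scale t135 (x \<diamondop> u)) + scale p4 (scale t135 (sharp x \<diamondop> u)
          + scale t1 (scale t135 u))
      + scale (t135 * u1) y + scale u2 (scale t135 u)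
      + scale (t135 * s1) (sharp x) + scale (t135 * s2) x + scale (t135 * s3) unt"
    by (simp add: comb_def scale_right_distrib mult.commute mult.left_commute)
  also have "\<dots> = lin
    (t135*s3 + c*u2 + (c*t1*p4 + c*t1*p4))
    (t135*s2 - c*p3)
    (t135*s1 - c*p4)
    (t135*u1 + t135*t1*p2 + t136*u2 + t136*t1*p4)
    (- u2 - t1*p4)
    (t135*p1 + t136*p3)
    (- p3)
    (t135*p2 + t136*p4)
    (- p4)"
    unfolding cross_u scale_u lin_def by (simp only: scale_left_distrib) (simp add: algebra_simps)
  also have "\<dots> = lin
    (t135*s3 + c*u2 + 2*c*t1*p4)
    (t135*s2 - c*p3)
    (t135*s1 - c*p4)
    (t135*u1 + t135*t1*p2 + t136*u2 + t136*t1*p4)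
    (- u2 - t1*p4)
    (t135*p1 + t136*p3)
    (- p3)
    (t135*p2 + t136*p4)
    (- p4)"
    by (rule lin_cong) simp_all
  finally show ?thesis .
qed

lemma comb_inject:
  "comb p1 p2 p3 p4 u1 u2 s1 s2 s3 = comb q1 q2 q3 q4 v1 v2 r1 r2 r3 \<longleftrightarrow>
    p1 = q1 \<and> p2 = q2 \<and> p3 = q3 \<and> p4 = q4 \<and> u1 = v1 \<and> u2 = v2 \<and> s1 = r1 \<and> s2 = r2 \<and> s3 = r3"
  (is "?l = ?r \<longleftrightarrow> ?eqs")
proof
  assume "?l = ?r"
  then have "scale t135 ?l = scale t135 ?r" by simp
  then show ?eqs
    unfolding scale_comb lin_inject[OF disc] using t135_nonzero by auto
qed simp

lemma comb_eq_0: "comb p1 p2 p3 p4 u1 u2 s1 s2 s3 = 0 \<longleftrightarrow> p1 = 0 \<and> p2 = 0 \<and> p3 = 0 \<and> p4 = 0 \<and> u1 = 0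
    \<and> u2 = 0 \<and> s1 = 0 \<and> s2 = 0 \<and> s3 = 0"
proof -
  have "comb 0 0 0 0 0 0 0 0 0 = 0" by (simp add: comb_def)
  then show ?thesis using comb_inject[of p1 p2 p3 p4 u1 u2 s1 s2 s3 0 0 0 0 0 0 0 0 0] by simp
qed

lemma basis_distinct: "distinct [x \<diamondop> y, sharp x \<diamondop> y + scale t1 y, x \<diamondop> u, sharp x \<diamondop> u
    + scale t1 u, y, u, sharp x, x, unt]"
proof -
  have "[x \<diamondop> y, sharp x \<diamondop> y + scale t1 y, x \<diamondop> u, sharp x \<diamondop> u + scale t1 u, y, u, sharp x, x, unt] =
    [comb 1 0 0 0 0 0 0 0 0,
     comb 0 1 0 0 0 0 0 0 0,
     comb 0 0 1 0 0 0 0 0 0,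
     comb 0 0 0 1 0 0 0 0 0,
     comb 0 0 0 0 1 0 0 0 0,
     comb 0 0 0 0 0 1 0 0 0,
     comb 0 0 0 0 0 0 1 0 0,
     comb 0 0 0 0 0 0 0 1 0,
     comb 0 0 0 0 0 0 0 0 1]"
    by (simp add: comb_def)
  then show ?thesis
    by (simp only: distinct.simps list.set insert_iff empty_iff comb_inject) simp
qed

lemma basis_independent: "independent {x \<diamondop> y, sharp x \<diamondop> y + scale t1 y, x \<diamondop> u, sharp x \<diamondop> u
    + scale t1 u, y, u, sharp x, x, unt}"
proof (rule independent_if_scalars_zero)
  fix f v
  let ?B = "[x \<diamondop> y, sharp x \<diamondop> y + scale t1 y, x \<diamondop> u, sharp x \<diamondop> u
      + scale t1 u, y, u, sharp x, x, unt]"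
  assume "(\<Sum>v\<in>{x \<diamondop> y, sharp x \<diamondop> y + scale t1 y, x \<diamondop> u, sharp x \<diamondop> u
      + scale t1 u, y, u, sharp x, x, unt}. scale (f v) v) = 0" and v: "v \<in> {x \<diamondop> y, sharp x \<diamondop> y
      + scale t1 y, x \<diamondop> u, sharp x \<diamondop> u + scale t1 u, y, u, sharp x, x, unt}"
  moreover have "(\<Sum>v\<in>set ?B. scale (f v) v) = comb (f (x \<diamondop> y)) (f (sharp x \<diamondop> y
      + scale t1 y)) (f (x \<diamondop> u)) (f (sharp x \<diamondop> u + scale t1 u)) (f (y)) (f (u)) (f (sharp x)) (f
      (x)) (f (unt))"
    unfolding sum.distinct_set_conv_list[OF basis_distinct] comb_def by (simp add: add.assoc)
  ultimately have "comb (f (x \<diamondop> y)) (f (sharp x \<diamondop> y + scale t1 y)) (f (x \<diamondop> u)) (f (sharp x \<diamondop> u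
      + scale t1 u)) (f (y)) (f (u)) (f (sharp x)) (f (x)) (f (unt)) = 0"
    by simp
  then show "f v = 0"
    using v unfolding comb_eq_0 by auto
qed simp

text \<open>
  Nine independent vectors span a space of dimension 9.
\<close>

lemma basis_span:
  assumes "dim UNIV = 9"
  shows "span {x \<diamondop> y, sharp x \<diamondop> y + scale t1 y, x \<diamondop> u, sharp x \<diamondop> u
      + scale t1 u, y, u, sharp x, x, unt} = UNIV"
proof -
  obtain n e where "ordered_basis scale n e"
    using jordan by (auto simp: cubic_jordan_algebra_def)
  then interpret finite_dimensional_vector_space scale "e ` {..<n}"
    by unfold_locales (auto simp: ordered_basis_def)
  have card: "card {x \<diamondop> y, sharp x \<diamondop> y + scale t1 y, x \<diamondop> u, sharp x \<diamondop> u
      + scale t1 u, y, u, sharp x, x, unt} = 9"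
    using distinct_card[OF basis_distinct] by simp
  have "UNIV \<subseteq> span {x \<diamondop> y, sharp x \<diamondop> y + scale t1 y, x \<diamondop> u, sharp x \<diamondop> u
      + scale t1 u, y, u, sharp x, x, unt}"
    by (rule card_ge_dim_independent[OF subset_UNIV basis_independent]) (simp only: assms card)
  then show ?thesis by auto
qed

lemma sharp_comb_iff:
  assumes "d = p1 * p4 - p2 * p3"
    and "U1 = p1^2 + t1 * p2^2 + p2 * u1"
    and "U2 = 2 * p1 * p3 + 2 * t1 * p2 * p4 + p4 * u1 + p2 * u2"
    and "U3 = p3^2 + t1 * p4^2 + p4 * u2"
    and "I1 = t2 * p2^2 + p1 * u1"
    and "I2 = 2 * t2 * p2 * p4 + p3 * u1 + p1 * u2"
    and "I3 = t2 * p4^2 + p3 * u2"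
    and "A1 = t1 * p2 * u1 - t2 * p1 * p2 + u1^2"
    and "A2 = t1 * (p4 * u1 + p2 * u2) - t2 * (p2 * p3 + p1 * p4) + 2 * u1 * u2"
    and "A3 = t1 * p4 * u2 - t2 * p3 * p4 + u2^2"
    and "\<alpha> = t136^2 - t135 * t245"
    and "\<beta> = t135 * t246 - t136 * t245"
    and "\<gamma> = t245^2 - t136 * t246"
    and "a0 = t123 * t136 - t124 * t135"
    and "a1 = t123 * t245 - t124 * t136"
    and "a2 = t123 * t246 - t124 * t245"
    and "b0 = t125 * t136 - t126 * t135"
    and "b1 = t125 * t245 - t126 * t136"
    and "b2 = t125 * t246 - t126 * t245"
    and "F1 = u1 * s1 - p1 * s2 - p2 * s3 - t126 * d - (t136 * U1 + t245 * U2 + t246 * U3)"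
    and "F2 = u2 * s1 - p3 * s2 - p4 * s3 + t125 * d + t135 * U1 + t136 * U2 + t245 * U3"
    and "F3 = - t2 * p2 * s1 + (t1 * p2 + u1) * s2 - p1 * s3 - t124 * d - (t136 * I1 + t245 * I2
        + t246 * I3)"
    and "F4 = - t2 * p4 * s1 + (t1 * p4 + u2) * s2 - p3 * s3 + t123 * d + t135 * I1 + t136 * I2
        + t245 * I3"
    and "F5 = - t2 * p1 * s1 + (t1 * p1 - t2 * p2) * s2 + (t1 * p2 + u1) * s3 + t123 * U1
        + t124 * (p1 * p3 + t1 * p2 * p4 + p2 * u2) - t125 * I1 - t126 * (t2 * p2 * p4 + p1 * u2)
        - (t136 * A1 + t245 * A2 + t246 * A3)"
    and "F6 = - t2 * p3 * s1 + (t1 * p3 - t2 * p4) * s2 + (t1 * p4 + u2) * s3 + t123 * (p1 * p3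
        + t1 * p2 * p4 + p4 * u1) + t124 * U3 - t125 * (t2 * p2 * p4 + p3 * u1) - t126 * I3
        + t135 * A1 + t136 * A2 + t245 * A3"
    and "F7 = s1 * s3 - s2^2 + (t123 * p2 + t124 * p4) * s1 - (t125 * p2 + t126 * p4) * s2
        + \<alpha> * (p1^2 - 2 * p2 * u1 - t1 * p2^2) + \<gamma> * (p3^2 - 2 * p4 * u2 - t1 * p4^2) + \<beta> * (p2 * u2
        + p4 * u1 - p1 * p3 + t1 * p2 * p4) + a0 * p2^2 + 2 * a1 * p2 * p4 + a2 * p4^2
        - b0 * p1 * p2 - b1 * (p1 * p4 + p2 * p3) - b2 * p3 * p4"
    and "F8 = s2 * s3 + t1 * s1 * s2 - t2 * s1^2 + (t123 * p1 + t124 * p3) * s1 - (t125 * p1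
        + t126 * p3) * s2 + \<alpha> * (-2 * p1 * u1 - 2 * t1 * p1 * p2 + t2 * p2^2) + \<gamma> * (-2 * p3 * u2
        - 2 * t1 * p3 * p4 + t2 * p4^2) + \<beta> * (p1 * u2 + p3 * u1 + t1 * (p1 * p4
        + p2 * p3)-t2 * p2 * p4) - b0 * p1^2 - 2 * b1 * p1 * p3 - b2 * p3^2 + a0 * p1 * p2
        + a1 * (p1 * p4 + p2 * p3) + a2 * p3 * p4"
    and "F9 = s3^2 + t1 * s2^2 - t2 * s1 * s2 + (t123 * u1 + t124 * u2) * s1 - (t125 * u1
        + t126 * u2) * s2 - \<alpha> * (2 * t2 * p1 * p2 + u1^2) + \<beta> * (t2 * (p2 * p3 + p1 * p4)+u1 * u2)
        - \<gamma> * (2 * t2 * p3 * p4 + u2^2) - t1 * (a0 * p2^2 + 2 * a1 * p2 * p4 + a2 * p4^2)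
        + t2 * (b0 * p2^2 + 2 * b1 * p2 * p4 + b2 * p4^2) - a0 * p1^2 - 2 * a1 * p1 * p3 - a2 * p3^2
        + (t124 * t125 - t123 * t126) * d"
  shows "sharp (comb p1 p2 p3 p4 u1 u2 s1 s2 s3) = comb adp1 adp2 adp3 adp4 adu1 adu2 ads1 ads2 ads3
      \<longleftrightarrow>
    adp2 = F1 \<and> adp4 = F2 \<and> adp1 = F3 \<and> adp3 = F4 \<and>
    - (adu1 + t1 * adp2) = F5 \<and> - (adu2 + t1 * adp4) = F6 \<and> - ads1 = F7 \<and> - ads2 = F8 \<and>
    ads3 + t1 * ads1 - t125 * adp1 + t123 * adp2 - t126 * adp3 + t124 * adp4 = F9"
proof -
  \<comment> \<open>the nine equations solved for the coordinates, which is possible because they are triangular\<close>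
  define q1 q2 q3 q4 v1 v2 r1 r2 r3 where q: "q1 = F3" "q2 = F1" "q3 = F4" "q4 = F2" "v1 = - F5
      - t1 * q2" "v2 = - F6 - t1 * q4" "r1 = - F7" "r2 = - F8" "r3 = F9 - t1 * r1 + t125 * q1
      - t123 * q2 + t126 * q3 - t124 * q4"
  have "scale (t135\<^sup>2) (sharp (comb p1 p2 p3 p4 u1 u2 s1 s2 s3)) = sharp (scale t135 (comb p1 p2 p3
      p4 u1 u2 s1 s2 s3))"
    by (simp add: sharp_scale)
  also have "\<dots> = lin
      (t135 * (t135*r3 + c*v2 + 2*c*t1*q4))
      (t135 * (t135*r2 - c*q3))
      (t135 * (t135*r1 - c*q4))
      (t135 * (t135*v1 + t135*t1*q2 + t136*v2 + t136*t1*q4))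
      (t135 * (- v2 - t1*q4))
      (t135 * (t135*q1 + t136*q3))
      (t135 * (- q3))
      (t135 * (t135*q2 + t136*q4))
      (t135 * (- q4))"
    unfolding scale_comb sharp_lin
    by (rule lin_cong; rule sharp_coordinates_polynomial[OF assms q refl refl refl S_y N_y refl
        T_x_sharp_y _ T_sharp_x_sharp_y
          refl refl refl refl refl refl refl refl refl]; simp)
  also have "\<dots> = scale (t135\<^sup>2) (comb q1 q2 q3 q4 v1 v2 r1 r2 r3)"
    unfolding power2_eq_square scale_scale[symmetric] scale_comb by (simp only: lin_scale)
  finally have sharp: "sharp (comb p1 p2 p3 p4 u1 u2 s1 s2 s3) = comb q1 q2 q3 q4 v1 v2 r1 r2 r3"
    using t135_nonzero by simp
  have neg: "- F - b = v \<longleftrightarrow> - (v + b) = F" for F b v :: 'a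
    by (simp only: diff_eq_eq minus_equation_iff[of F])
  show ?thesis
    unfolding sharp comb_inject unfolding q neg by (auto simp: algebra_simps)
qed

end

lemma three_nonzero:
  assumes "CHAR('a::field) \<noteq> 3"
  shows "(3::'a) \<noteq> 0"
proof
  assume "(3::'a) = 0"
  then have "CHAR('a) dvd 3"
    using of_nat_eq_0_iff_char_dvd[of 3, where ?'a = 'a] by simp
  moreover have "\<not> CHAR('a) dvd 1"
    using of_nat_eq_0_iff_char_dvd[of 1, where ?'a = 'a] by simp
  moreover have "d = 1 \<or> d = 3" if "d dvd 3" for d :: nat
  proof -
    have "d \<le> 3" using that by (rule dvd_imp_le) simp
    then have "d = 0 \<or> d = 1 \<or> d = 2 \<or> d = 3" by linarith
    then show ?thesis using that by auto
  qed
  ultimately show False using assms by force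
qed

theorem proposition4p9:
  fixes scale :: "'k::field \<Rightarrow> 'j::ab_group_add \<Rightarrow> 'j"
    and N :: "'j \<Rightarrow> 'k" and dN :: "'j \<Rightarrow> 'j \<Rightarrow> 'k" and sharp :: "'j \<Rightarrow> 'j" and unt :: 'j
    and T :: "'j \<Rightarrow> 'j \<Rightarrow> 'k" and S :: "'j \<Rightarrow> 'k" and U :: "'j \<Rightarrow> 'j \<Rightarrow> 'j" and cross :: "'j \<Rightarrow> 'j \<Rightarrow> 'j"
    and \<sigma> \<upsilon> \<sigma>1 \<sigma>2 \<sigma>3 \<upsilon>1 \<upsilon>2 \<pi>1 \<pi>2 \<pi>3 \<pi>4 :: 'j
    and t1 t2 t123 t124 t125 t126 t135 t136 t245 t246 :: 'k
  assumes char: "CHAR('k) \<noteq> 3"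
    and J: "cubic_jordan_algebra scale N dN sharp unt"
    and dim: "vector_space.dim scale (UNIV :: 'j set) = 9"
    and T: "T = trace_form dN unt"
    and S: "S = (\<lambda>x. T (sharp x) unt)"
    and cross: "cross = polar sharp"
    and U: "U = U_op scale dN sharp unt"
    and nondeg: "nondegenerate_jordan U"
    and simple: "simple_jordan scale U"
    and T_nondeg: "\<forall>x. (\<forall>y. T x y = 0) \<longrightarrow> x = 0"
    and idempotents: "\<exists>e1 e2 e3. unt = e1 + e2 + e3 \<and>
          primitive_idempotent U unt e1 \<and> primitive_idempotent U unt e2 \<and> primitive_idempotent U unt e3 \<and>
          orthogonal_idempotents U unt e1 e2 \<and> orthogonal_idempotents U unt e1 e3 \<and>
          orthogonal_idempotents U unt e2 e3"
    and \<sigma>\<upsilon>: "T \<sigma> unt = 0" "T \<upsilon> unt = 0"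
    and D: "disc_D (N \<sigma>) (N \<upsilon>) (S \<sigma>) (S \<upsilon>) (T \<sigma> \<upsilon>) (T \<sigma> (sharp \<upsilon>)) (T (sharp \<sigma>) \<upsilon>)
              (T (sharp \<sigma>) (sharp \<upsilon>)) \<noteq> 0"
    and \<sigma>s: "\<sigma>2 = \<sigma>" "\<sigma>1 = sharp \<sigma>" "\<sigma>3 = unt"
    and \<upsilon>1: "\<upsilon>1 = \<upsilon>"
    and \<upsilon>2: "\<upsilon>2 \<in> module.span scale {\<upsilon>1, sharp \<upsilon>1, unt}" "T \<upsilon>2 unt = 0"
            "module.span scale {\<upsilon>1, sharp \<upsilon>1, unt} = module.span scale {\<upsilon>1, \<upsilon>2, unt}"
    and t12: "t1 = S \<sigma>" "t2 = N \<sigma>"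
    and t12x: "t123 = - T \<sigma>1 \<upsilon>1" "t124 = - T \<sigma>1 \<upsilon>2" "t125 = T \<sigma>2 \<upsilon>1" "t126 = T \<sigma>2 \<upsilon>2"
    and sharp_\<upsilon>1: "sharp \<upsilon>1 = scale t136 \<upsilon>1 - scale t135 \<upsilon>2 + scale (1 / 3 * S \<upsilon>1) unt"
    and sharp_\<upsilon>2: "sharp \<upsilon>2 = scale t246 \<upsilon>1 - scale t245 \<upsilon>2 + scale (1 / 3 * S \<upsilon>2) unt"
    and \<pi>s: "\<pi>1 = cross \<sigma>2 \<upsilon>1" "\<pi>2 = cross (sharp \<sigma>2) \<upsilon>1 + scale t1 \<upsilon>1"
            "\<pi>3 = cross \<sigma>2 \<upsilon>2" "\<pi>4 = cross (sharp \<sigma>2) \<upsilon>2 + scale t1 \<upsilon>2"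
  shows "distinct [\<pi>1, \<pi>2, \<pi>3, \<pi>4, \<upsilon>1, \<upsilon>2, \<sigma>1, \<sigma>2, \<sigma>3] \<and>
         \<not> module.dependent scale {\<pi>1, \<pi>2, \<pi>3, \<pi>4, \<upsilon>1, \<upsilon>2, \<sigma>1, \<sigma>2, \<sigma>3} \<and>
         module.span scale {\<pi>1, \<pi>2, \<pi>3, \<pi>4, \<upsilon>1, \<upsilon>2, \<sigma>1, \<sigma>2, \<sigma>3} = UNIV \<and>
    (\<forall>p1 p2 p3 p4 u1 u2 s1 s2 s3
      adp1 adp2 adp3 adp4 adu1 adu2 ads1 ads2 ads3.
     (let
         d = p1 * p4 - p2 * p3;
         U1 = p1^2 + t1 * p2^2 + p2 * u1;
         U2 = 2 * p1 * p3 + 2 * t1 * p2 * p4 + p4 * u1 + p2 * u2;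
         U3 = p3^2 + t1 * p4^2 + p4 * u2;
         I1 = t2 * p2^2 + p1 * u1;
         I2 = 2 * t2 * p2 * p4 + p3 * u1 + p1 * u2;
         I3 = t2 * p4^2 + p3 * u2;
         A1 = t1 * p2 * u1 - t2 * p1 * p2 + u1^2;
         A2 = t1 * (p4 * u1 + p2 * u2) - t2 * (p2 * p3 + p1 * p4) + 2 * u1 * u2;
         A3 = t1 * p4 * u2 - t2 * p3 * p4 + u2^2;
         \<alpha> = t136^2 - t135 * t245;
         \<beta> = t135 * t246 - t136 * t245;
         \<gamma> = t245^2 - t136 * t246;
         a0 = t123 * t136 - t124 * t135;
         a1 = t123 * t245 - t124 * t136;
         a2 = t123 * t246 - t124 * t245;
         b0 = t125 * t136 - t126 * t135;
         b1 = t125 * t245 - t126 * t136;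
         b2 = t125 * t246 - t126 * t245;
         F1 = u1 * s1 - p1 * s2 - p2 * s3 - t126 * d - (t136 * U1 + t245 * U2 + t246 * U3);
         F2 = u2 * s1 - p3 * s2 - p4 * s3 + t125 * d + t135 * U1 + t136 * U2 + t245 * U3;
         F3 = - t2 * p2 * s1 + (t1 * p2 + u1) * s2 - p1 * s3 - t124 * d
              - (t136 * I1 + t245 * I2 + t246 * I3);
         F4 = - t2 * p4 * s1 + (t1 * p4 + u2) * s2 - p3 * s3 + t123 * d + t135 * I1 + t136 * I2
              + t245 * I3;
         F5 = - t2 * p1 * s1 + (t1 * p1 - t2 * p2) * s2 + (t1 * p2 + u1) * s3 + t123 * U1
              + t124 * (p1 * p3 + t1 * p2 * p4 + p2 * u2) - t125 * I1 - t126 * (t2 * p2 * p4 + p1 * u2)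
              - (t136 * A1 + t245 * A2 + t246 * A3);
         F6 = - t2 * p3 * s1 + (t1 * p3 - t2 * p4) * s2 + (t1 * p4 + u2) * s3
              + t123 * (p1 * p3 + t1 * p2 * p4 + p4 * u1) + t124 * U3 - t125 * (t2 * p2 * p4 + p3 * u1)
              - t126 * I3 + t135 * A1 + t136 * A2 + t245 * A3;
         F7 = s1 * s3 - s2^2 + (t123 * p2 + t124 * p4) * s1 - (t125 * p2 + t126 * p4) * s2
              + \<alpha> * (p1^2 - 2 * p2 * u1 - t1 * p2^2) + \<gamma> * (p3^2 - 2 * p4 * u2 - t1 * p4^2)
              + \<beta> * (p2 * u2 + p4 * u1 - p1 * p3 + t1 * p2 * p4) + a0 * p2^2 + 2 * a1 * p2 * p4
              + a2 * p4^2 - b0 * p1 * p2 - b1 * (p1 * p4 + p2 * p3) - b2 * p3 * p4;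
         F8 = s2 * s3 + t1 * s1 * s2 - t2 * s1^2 + (t123 * p1 + t124 * p3) * s1
              - (t125 * p1 + t126 * p3) * s2 + \<alpha> * (-2 * p1 * u1 - 2 * t1 * p1 * p2 + t2 * p2^2)
              + \<gamma> * (-2 * p3 * u2 - 2 * t1 * p3 * p4 + t2 * p4^2)
              + \<beta> * (p1 * u2 + p3 * u1 + t1 * (p1 * p4 + p2 * p3)-t2 * p2 * p4) - b0 * p1^2
              - 2 * b1 * p1 * p3 - b2 * p3^2 + a0 * p1 * p2 + a1 * (p1 * p4 + p2 * p3)
              + a2 * p3 * p4;
         F9 = s3^2 + t1 * s2^2 - t2 * s1 * s2 + (t123 * u1 + t124 * u2) * s1
              - (t125 * u1 + t126 * u2) * s2 - \<alpha> * (2 * t2 * p1 * p2 + u1^2)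
              + \<beta> * (t2 * (p2 * p3 + p1 * p4)+u1 * u2) - \<gamma> * (2 * t2 * p3 * p4 + u2^2)
              - t1 * (a0 * p2^2 + 2 * a1 * p2 * p4 + a2 * p4^2)
              + t2 * (b0 * p2^2 + 2 * b1 * p2 * p4 + b2 * p4^2) - a0 * p1^2 - 2 * a1 * p1 * p3
              - a2 * p3^2 + (t124 * t125 - t123 * t126) * d
      in sharp (scale p1 \<pi>1 + scale p2 \<pi>2 + scale p3 \<pi>3 + scale p4 \<pi>4 + scale u1 \<upsilon>1
                + scale u2 \<upsilon>2 + scale s1 \<sigma>1 + scale s2 \<sigma>2 + scale s3 \<sigma>3)
         = scale adp1 \<pi>1 + scale adp2 \<pi>2 + scale adp3 \<pi>3 + scale adp4 \<pi>4 + scale adu1 \<upsilon>1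
           + scale adu2 \<upsilon>2 + scale ads1 \<sigma>1 + scale ads2 \<sigma>2 + scale ads3 \<sigma>3
         \<longleftrightarrow>
         adp2 = F1 \<and> adp4 = F2 \<and> adp1 = F3 \<and> adp3 = F4 \<and>
         - (adu1 + t1 * adp2) = F5 \<and> - (adu2 + t1 * adp4) = F6 \<and> - ads1 = F7 \<and> - ads2 = F8 \<and>
         ads3 + t1 * ads1 - t125 * adp1 + t123 * adp2 - t126 * adp3 + t124 * adp4 = F9))"
proof -
  interpret vector_space scale
    using J by (simp add: cubic_jordan_algebra_def)
  have tf: "trace_form dN unt = T" by (simp add: T)
  interpret adapted_pair scale N dN sharp unt \<sigma> \<upsilon> \<upsilon>2 t135 t136 t245 t246
    using three_nonzero[OF char] J T_nondeg \<sigma>\<upsilon> D sharp_\<upsilon>1 sharp_\<upsilon>2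
    by unfold_locales (auto simp: tf S \<upsilon>1)
  note names = \<pi>s \<sigma>s \<upsilon>1 t12 t12x cross S T
  show ?thesis
    unfolding names Let_def
    apply (intro conjI allI)
    subgoal by (rule basis_distinct)
    subgoal by (rule basis_independent)
    subgoal by (rule basis_span) (rule dim)
    subgoal for p1 p2 p3 p4 u1 u2 s1 s2 s3 adp1 adp2 adp3 adp4 adu1 adu2 ads1 ads2 ads3
      unfolding comb_def[symmetric] by (rule sharp_comb_iff[OF refl refl refl refl refl refl refl refl refl refl refl refl refl refl refl refl refl refl refl refl refl refl refl refl refl refl refl refl])
    done
qed

end
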